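(* Let $f(z)$ be a meromorphic function of finite order $\sigma=\sigma(f)$ and let $\varepsilon>0$ denote a positive constant. (i) If $\sigma\ge1$, let $0<\beta<1$ and $0<|\omega|<r^\beta$, and let $0<\varepsilon<\beta''$, where $\beta''=\min\{(\sigma-1)(1-\beta)/\beta,\ (1-\beta)/(2-\beta)\}$. Then $$T\big(r,f(z+\omega)\big)=T(r,f)+O\big(r^{\sigma-(1-\beta)(1-\varepsilon)+\varepsilon}\big)$$ holds outside a set of finite logarithmic measure. (ii) If $0<\sigma<1$, $0<\beta<\sigma$ and $0<|\omega|<r^\beta$, then $$T\big(r,f(z+\omega)\big)=T(r,f)+O(r^{\beta})$$ outside a set of finite logarithmic measure. (iii) If $\sigma=0$, let $0<|\omega|<\log^{\frac12}r$ for $r>1$ and $0<|\omega|<1$ for $r\le1$. Then $$T\big(r,f(z+\omega)\big)=T(r,f)+O(\log r)$$ outside a set of finite logarithmic measure.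
   Context: $T(r,g)$ is the Nevanlinna characteristic; the order of $f$ is $\sigma=\limsup_{r\to\infty}\log^+T(r,f)/\log r$. The step $\omega=\omega(r)\in\mathbb{C}$ may vary with $r$ freely subject only to the stated bounds; for each $r$, $T(r,f(z+\omega))$ is the characteristic of $z\mapsto f(z+\omega)$ with that value of $\omega$. The relations are asymptotic as $r\to\infty$, for $r$ outside a set $E\subset(1,\infty)$ of finite logarithmic measure, i.e. $\int_E dr/r<\infty$. $\log^{1/2}r=(\log r)^{1/2}$.
   Formalization: T(r,f) is taken with N(r,f) = ∫_1^r n(t,f)/t dt; with the usual N (integral from 0, n(0,f) log r) the claim fails for freely varying ω: f = 1/z, ω = e^{-r} for large r gives T(r,f(z+ω)) − T(r,f) = r. *)

theory Defs
  imports "HOL-Complex_Analysis.Complex_Analysis" "HOL-Library.Landau_Symbols"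
begin

(* max 0 (ln x) for x > 0, with the usual convention log^+ 0 = 0 *)
definition log_plus :: "real \<Rightarrow> real" where
  "log_plus x = ln (max 1 x)"

(* Proximity function m(r,f). *)
definition nev_m :: "real \<Rightarrow> (complex \<Rightarrow> complex) \<Rightarrow> real" where
  "nev_m r f =
     1 / (2 * pi) * integral {0..2 * pi} (\<lambda>\<theta>. log_plus (norm (f (of_real r * cis \<theta>))))"

(* Unintegrated counting function n(r,f): poles in the closed disc, with multiplicity.
   Neither is_pole nor zorder looks at the value of f at the point itself, so f may take
   arbitrary values at its poles. *)
definition nev_n :: "real \<Rightarrow> (complex \<Rightarrow> complex) \<Rightarrow> nat" where
  "nev_n r f = (\<Sum>z | is_pole f z \<and> norm z \<le> r. nat (- zorder f z))"

(* Integrated counting function, normalised as the integral of n(t,f)/t over [1,r]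
   (r \<ge> 1).  For a fixed f this differs only by a constant from the other customary
   normalisation
     (integral over [0,r] of (n(t,f) - n(0,f))/t) + n(0,f) log r.
   Pitfall: for a translate f(z + w) that constant depends on w and is unbounded as w
   approaches a pole of f without reaching it.  With the other normalisation the function
   1/(z + w), of characteristic log (r/|w|) for large r, shows that no estimate of
   T(r, f(z + w)) - T(r, f) can be uniform in 0 < |w| < 1, so w could not vary freely
   with r. *)
definition nev_N :: "real \<Rightarrow> (complex \<Rightarrow> complex) \<Rightarrow> real" where
  "nev_N r f = integral {1..r} (\<lambda>t. real (nev_n t f) / t)"

definition nev_T :: "real \<Rightarrow> (complex \<Rightarrow> complex) \<Rightarrow> real" where
  "nev_T r f = nev_m r f + nev_N r f"

definition nev_order :: "(complex \<Rightarrow> complex) \<Rightarrow> ereal" where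
  "nev_order f = Limsup at_top (\<lambda>r. ereal (log_plus (nev_T r f) / ln r))"

definition finite_log_measure :: "real set \<Rightarrow> bool" where
  "finite_log_measure E \<longleftrightarrow>
     E \<in> sets lebesgue \<and> E \<subseteq> {1<..} \<and> (\<integral>\<^sup>+ r\<in>E. ennreal (1 / r) \<partial>lebesgue) < \<infinity>"

(* g = h + O(e) as r tends to infinity outside a set of finite logarithmic measure *)
definition eq_bigo_outside ::
    "(real \<Rightarrow> real) \<Rightarrow> (real \<Rightarrow> real) \<Rightarrow> (real \<Rightarrow> real) \<Rightarrow> bool" where
  "eq_bigo_outside g h e \<longleftrightarrow>
     (\<exists>E. finite_log_measure E \<and> (\<lambda>r. g r - h r) \<in> O[inf at_top (principal (- E))](e))"

end

theory Submission imports Defs "HOL-Real_Asymp.Real_Asymp" begin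

text \<open>
  On a disc of radius comparable to $r$ write $f = e^h P / Q$, with polynomials $P$, $Q$ carrying
  the zeros and poles. Since the mean of $\log |z - a|$ over $|z| = r$ is $\log \max(r, |a|)$, the
  proximity and counting functions combine to
  $$T(r, f(z+\omega)) = \mathrm{mean}_{|z|=r} \max(\log |Q|, \log |e^h P|)(z+\omega)
      - \sum_b \log \max(1, |b-\omega|),$$
  the sum ranging over the poles. The effect of $\omega$ on the mean is controlled by the means of
  $|\log |z+\omega-c| - \log |z-c||$, which are $O((|\omega|/r)^\alpha)$ uniformly in $c$ for
  every $\alpha < 1$, and by $|\omega| \sup |h'|$, where $h'$ is an integral of $\mathrm{Re}\, h$
  over a larger circle. Jensen's formula bounds both $\mathrm{Re}\, h$ and the number of zeros and
  poles by $T$. In the sum over the poles, those with $|b| < 2|\omega|$ contribute at most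
  $\log(1+|\omega|)$ each and the others at most $2|\omega|/|b|$. Averaging over the whole circle
  instead of estimating pointwise makes every bound valid for all large $r$, so the exceptional set
  can be taken empty.
\<close>

subsection \<open>Means over circles\<close>

text \<open>The difficulty is uniformity: \<omega> may depend on r in any way, so z + \<omega> can
  come arbitrarily close to zeros and poles, and no useful bound for log |f(z+\<omega>)/f(z)| holds
  at every point of the circle. A maximum of two functions moves by at most the sum of their moves,
  so it is enough to average the change of each log |z - c|; \<alpha> < 1 is forced because |z -
  c|^(-\<alpha>) must be integrable along the circle even when c lies on it. For \<tau> above the
  order the error has three parts: r^(\<tau>-\<alpha>) |\<omega>|^\<alpha> log r from the factors
  and h, max(1,|\<omega>|)^\<tau> log(1+|\<omega>|) from the near poles, and |\<omega>|
  r^max(\<tau>-1,0) from the far ones. The first yields the exponent for order at least 1, the last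
  the r^\<beta> for order between 0 and 1. P, Q and h change with r. The constants depend on f alone
  because Jensen's formula is normalised on the unit circle, which eliminates h(0). The radii are r
  for the mean, 2r for the segments from z to z + \<omega>, 4r for the circle carrying Re h, and 5r
  for the factorisation.\<close>

definition circ_int :: "real \<Rightarrow> (complex \<Rightarrow> real) \<Rightarrow> bool" where
  "circ_int r u \<longleftrightarrow> integrable (lebesgue_on {0..2*pi}) (\<lambda>t. u (of_real r * cis t))"

text \<open>Lebesgue integration, rather than the gauge integral of \<open>nev_m\<close>, gives
  domination and comparison almost everywhere, which the logarithmic singularities on the circle
  call for; \<open>circ_mean_integral\<close> translates back.\<close>

definition circ_mean :: "real \<Rightarrow> (complex \<Rightarrow> real) \<Rightarrow> real" where
  "circ_mean r u = (1 / (2*pi)) * (\<integral>t. u (of_real r * cis t) \<partial>lebesgue_on {0..2*pi})"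

lemma circ_int_add [intro]: "circ_int r u \<Longrightarrow> circ_int r v \<Longrightarrow> circ_int r (\<lambda>z. u z + v z)"
  and circ_int_diff [intro]: "circ_int r u \<Longrightarrow> circ_int r v \<Longrightarrow> circ_int r (\<lambda>z. u z - v z)"
  and circ_int_cmult [intro]: "circ_int r u \<Longrightarrow> circ_int r (\<lambda>z. c * u z)"
  and circ_int_abs [intro]: "circ_int r u \<Longrightarrow> circ_int r (\<lambda>z. \<bar>u z\<bar>)"
  and circ_int_max [intro]: "circ_int r u \<Longrightarrow> circ_int r v \<Longrightarrow> circ_int r (\<lambda>z. max (u z) (v z))"
  and circ_int_sum [intro]: "(\<And>i. i \<in> I \<Longrightarrow> circ_int r (w i)) \<Longrightarrow> circ_int r (\<lambda>z. \<Sum>i\<in>I. w i z)"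
  by (auto simp: circ_int_def)

lemma circ_int_const [intro, simp]: "circ_int r (\<lambda>z. c)"
  unfolding circ_int_def by (simp add: finite_measure.integrable_const finite_measure_lebesgue_on)

lemma circ_mean_add: "circ_int r u \<Longrightarrow> circ_int r v \<Longrightarrow> circ_mean r (\<lambda>z. u z + v z) = circ_mean r u + circ_mean r v"
  and circ_mean_diff: "circ_int r u \<Longrightarrow> circ_int r v \<Longrightarrow> circ_mean r (\<lambda>z. u z - v z) = circ_mean r u - circ_mean r v"
  and circ_mean_cmult: "circ_mean r (\<lambda>z. c * u z) = c * circ_mean r u"
  and circ_mean_sum: "(\<And>i. i \<in> I \<Longrightarrow> circ_int r (w i)) \<Longrightarrow>
     circ_mean r (\<lambda>z. \<Sum>i\<in>I. w i z) = (\<Sum>i\<in>I. circ_mean r (w i))"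
  by (auto simp: circ_int_def circ_mean_def distrib_left right_diff_distrib add_divide_distrib diff_divide_distrib sum_divide_distrib)

lemma circ_mean_const [simp]: "circ_mean r (\<lambda>z. c) = c"
  by (simp add: circ_mean_def measure_restrict_space)

lemma circ_mean_integral: "circ_int r u \<Longrightarrow> circ_mean r u = 1 / (2*pi) * integral {0..2*pi} (\<lambda>t. u (of_real r * cis t))"
  by (simp add: circ_int_def circ_mean_def lebesgue_integral_eq_integral)

text \<open>Makes finitely many exceptional points of the circle negligible in the angle. The
  parametrisation is injective only on the half-open interval, so the endpoint \<open>2*pi\<close>
  is added back by hand.\<close>

lemma finite_circle_preimage:
  assumes "r > 0" "finite F"
  shows "finite {t \<in> {0..2*pi}. of_real r * cis t \<in> F}"
proof -
  have "inj_on (\<lambda>t. of_real r * cis t) {0..<2*pi}"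
  proof (rule inj_onI)
    fix x y assume xy: "x \<in> {0..<2*pi}" "y \<in> {0..<2*pi}" "of_real r * cis x = of_real r * cis y"
    then have "cis x = cis y" using assms by simp
    then have "sin x = sin y \<and> cos x = cos y" by (metis cis.sel)
    then obtain n :: int where "x = y + 2 * pi * n" by (auto simp: sin_cos_eq_iff)
    moreover then have "n = 0"
    proof -
      have "\<bar>2 * pi * n\<bar> < 2 * pi" using xy \<open>x = y + 2 * pi * n\<close> by auto
      then have "\<bar>real_of_int n\<bar> < 1" by (simp add: abs_mult)
      then show ?thesis by linarith
    qed
    ultimately show "x = y" by simp
  qed
  then have "finite ((\<lambda>t. of_real r * cis t) -` F \<inter> {0..<2*pi})"
    using finite_vimage_IntI assms(2) by blast
  then have "finite (insert (2*pi) ((\<lambda>t. of_real r * cis t) -` F \<inter> {0..<2*pi}))" by simp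
  then show ?thesis by (rule rev_finite_subset) auto
qed

lemma AE_circle:
  assumes "r > 0" "finite F" "\<And>z. norm z = r \<Longrightarrow> z \<notin> F \<Longrightarrow> P z"
  shows "AE t in lebesgue_on {0..2*pi}. P (of_real r * cis t)"
proof -
  let ?N = "{t \<in> {0..2*pi}. of_real r * cis t \<in> F}"
  have "negligible ?N" using finite_circle_preimage[OF assms(1,2)] by (rule negligible_finite)
  then have "?N \<in> null_sets lebesgue" by (simp add: negligible_iff_null_sets)
  then have "AE t in lebesgue. t \<notin> ?N" by (rule AE_not_in)
  then have "AE t in lebesgue. t \<in> {0..2*pi} \<longrightarrow> P (of_real r * cis t)"
    by eventually_elim (use assms in \<open>auto simp: norm_mult\<close>)
  then show ?thesis by (simp add: AE_restrict_space_iff)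
qed

text \<open>The set \<open>F\<close> absorbs the points where a logarithm or a negative power is
  evaluated at 0: there the conventions \<open>ln 0 = 0\<close> and \<open>0 powr x = 0\<close> give
  values for which the pointwise inequality can fail.\<close>

lemma circ_mean_mono:
  assumes "r > 0" "finite F" "circ_int r u" "circ_int r v"
    "\<And>z. norm z = r \<Longrightarrow> z \<notin> F \<Longrightarrow> u z \<le> v z"
  shows "circ_mean r u \<le> circ_mean r v"
  unfolding circ_mean_def
  by (intro mult_left_mono integral_mono_AE AE_circle) (use assms in \<open>auto simp: circ_int_def\<close>)

lemma circ_mean_cong:
  assumes "r > 0" "finite F" "circ_int r u" "circ_int r v"
    "\<And>z. norm z = r \<Longrightarrow> z \<notin> F \<Longrightarrow> u z = v z"
  shows "circ_mean r u = circ_mean r v"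
  by (intro antisym circ_mean_mono[of r F]) (use assms in auto)

lemma circ_mean_cong_sphere:
  assumes "r > 0" "\<And>z. norm z = r \<Longrightarrow> u z = v z"
  shows "circ_mean r u = circ_mean r v"
proof -
  have "u (of_real r * cis t) = v (of_real r * cis t)" for t
    by (rule assms(2)) (use assms(1) in \<open>simp add: norm_mult\<close>)
  then show ?thesis by (simp add: circ_mean_def)
qed

lemma circ_mean_abs: "circ_int r u \<Longrightarrow> \<bar>circ_mean r u\<bar> \<le> circ_mean r (\<lambda>z. \<bar>u z\<bar>)"
  using integral_abs_bound[of "lebesgue_on {0..2*pi}" "\<lambda>t. u (of_real r * cis t)"]
  by (auto simp: circ_mean_def abs_mult mult_left_mono divide_right_mono)

lemma borel_measurable_lebesgue_on:
  fixes f :: "real \<Rightarrow> real"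
  assumes "f \<in> borel_measurable borel"
  shows "f \<in> borel_measurable (lebesgue_on S)"
proof -
  have "f \<in> borel_measurable lborel" using assms by simp
  then have "f \<in> borel_measurable lebesgue" by (rule measurable_completion)
  then show ?thesis by (rule measurable_restrict_space1)
qed

lemma measurable_circle:
  fixes u :: "complex \<Rightarrow> real"
  assumes "u \<in> borel_measurable borel"
  shows "(\<lambda>t. u (of_real r * cis t)) \<in> borel_measurable (lebesgue_on {0..2*pi})"
proof -
  have "(\<lambda>t. of_real r * cis t) \<in> borel_measurable borel"
    by (intro borel_measurable_continuous_onI continuous_intros)
  then have "(\<lambda>t. u (of_real r * cis t)) \<in> borel_measurable borel"
    using assms measurable_compose by blast
  then show ?thesis by (rule borel_measurable_lebesgue_on)
qed

lemma circ_int_bound: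
  assumes "circ_int r v" "r > 0" "finite F" "u \<in> borel_measurable borel"
    "\<And>z. norm z = r \<Longrightarrow> z \<notin> F \<Longrightarrow> \<bar>u z\<bar> \<le> v z"
  shows "circ_int r u"
  unfolding circ_int_def
proof (rule Bochner_Integration.integrable_bound)
  show "integrable (lebesgue_on {0..2*pi}) (\<lambda>t. v (of_real r * cis t))" using assms(1) by (simp add: circ_int_def)
  show "AE t in lebesgue_on {0..2*pi}. norm (u (of_real r * cis t)) \<le> norm (v (of_real r * cis t))"
    by (rule AE_circle[OF assms(2,3), where P="\<lambda>z. norm (u z) \<le> norm (v z)"]) (use assms in force)
qed (rule measurable_circle[OF assms(4)])

lemma circ_int_continuous:
  assumes "continuous_on (sphere 0 \<bar>r\<bar>) u"
  shows "circ_int r u"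
proof -
  have "continuous_on {0..2*pi} (\<lambda>t. u (of_real r * cis t))"
    by (intro continuous_on_compose2[OF assms] continuous_intros) (auto simp: norm_mult)
  then show ?thesis unfolding circ_int_def
    using absolutely_integrable_continuous_real integrable_restrict_space set_integrable_def
    by (metis absolutely_integrable_measurable_real integrable_abs_cancel sets_lebesgue_on_refl atLeastAtMost_borel sets_completionI_sets sets_lborel)
qed

subsection \<open>Negative powers of the distance to a point\<close>

text \<open>Jordan's inequality: by concavity on [0, pi] the sine lies above its chord from 0 to
  pi/2.\<close>

lemma abs_sin_ge:
  assumes "\<bar>x\<bar> \<le> pi/2"
  shows "\<bar>sin x\<bar> \<ge> 2 / pi * \<bar>x\<bar>"
proof -
  have cv: "convex_on {0..pi} (\<lambda>x. - sin x)"
  proof (rule f''_ge0_imp_convex)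
    show "((\<lambda>x. - sin x) has_real_derivative - cos x) (at x)" for x by (auto intro!: derivative_eq_intros)
    show "((\<lambda>x. - cos x) has_real_derivative sin x) (at x)" for x by (auto intro!: derivative_eq_intros)
    show "x \<in> {0..pi} \<Longrightarrow> 0 \<le> sin x" for x by (auto intro: sin_ge_zero)
  qed auto
  have *: "sin y \<ge> 2 / pi * y" if "0 \<le> y" "y \<le> pi/2" for y
  proof -
    have "- sin ((1 - 2/pi*y) *\<^sub>R 0 + (2/pi*y) *\<^sub>R (pi/2)) \<le> (1 - 2/pi*y) * - sin 0 + (2/pi*y) * - sin (pi/2)"
      using that by (intro convex_onD[OF cv]) (auto simp: field_simps)
    then show ?thesis by simp
  qed
  show ?thesis
  proof (cases "x \<ge> 0")
    case True
    then have "sin x \<ge> 2 / pi * x" using * assms by auto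
    then show ?thesis using True by (simp add: abs_if)
  next
    case False
    then have "sin (-x) \<ge> 2 / pi * (-x)" using *[of "-x"] assms by auto
    then show ?thesis using False by (simp add: abs_if)
  qed
qed

text \<open>The antiderivative is continuous across the singularity \<open>c\<close> because p > 0,
  so the fundamental theorem applies with exceptional set {c}. The positive parts let one formula
  cover every position of \<open>c\<close> relative to the interval.\<close>

lemma has_integral_abs_powr:
  fixes a b c p :: real
  assumes "a \<le> b" "p > 0"
  shows "((\<lambda>x. \<bar>x - c\<bar> powr (p - 1)) has_integral
     ((max 0 (b-c) powr p - max 0 (c-b) powr p) / p - (max 0 (a-c) powr p - max 0 (c-a) powr p) / p)) {a..b}"
proof (rule fundamental_theorem_of_calculus_strong[of "{c}"])
  fix x assume x: "x \<in> {a..b} - {c}"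
  consider "x > c" | "x < c" using x by force
  then have "((\<lambda>x. (max 0 (x-c) powr p - max 0 (c-x) powr p) / p) has_real_derivative \<bar>x - c\<bar> powr (p - 1)) (at x)"
  proof cases
    case 1
    have "((\<lambda>x. (x-c) powr p / p) has_real_derivative \<bar>x - c\<bar> powr (p - 1)) (at x)"
      using 1 assms by (auto intro!: derivative_eq_intros)
    then show ?thesis
      by (rule has_field_derivative_transform_within_open[of _ _ _ "{c<..}"]) (use 1 in auto)
  next
    case 2
    have "((\<lambda>x. - ((c-x) powr p / p)) has_real_derivative \<bar>x - c\<bar> powr (p - 1)) (at x)"
      using 2 assms by (auto intro!: derivative_eq_intros)
    then show ?thesis
      by (rule has_field_derivative_transform_within_open[of _ _ _ "{..<c}"]) (use 2 in auto)
  qed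
  then show "((\<lambda>x. (max 0 (x-c) powr p - max 0 (c-x) powr p) / p) has_vector_derivative \<bar>x - c\<bar> powr (p - 1)) (at x)"
    by (simp add: has_real_derivative_iff_has_vector_derivative)
next
  show "continuous_on {a..b} (\<lambda>x. (max 0 (x-c) powr p - max 0 (c-x) powr p) / p)"
    using assms by (intro continuous_intros continuous_on_powr') auto
qed (use assms in auto)

text \<open>The constants are made for the zeros a + k pi of a shifted sine with |a| \<le> pi and -1
  \<le> k \<le> 3: they lie within 4 pi < 13 of the origin, and 2 pi + 13 < 20.\<close>

lemma integral_abs_powr_le:
  fixes c p :: real
  assumes "p > 0" "\<bar>c\<bar> \<le> 13"
  shows "integrable (lebesgue_on {0..2*pi}) (\<lambda>x. \<bar>x - c\<bar> powr (p - 1))"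
    "(\<integral>x. \<bar>x - c\<bar> powr (p - 1) \<partial>lebesgue_on {0..2*pi}) \<le> 2 * 20 powr p / p"
proof -
  note h = has_integral_abs_powr[of 0 "2*pi" p c]
  have "(\<lambda>x. \<bar>x - c\<bar> powr (p - 1)) absolutely_integrable_on {0..2*pi}"
    by (rule nonnegative_absolutely_integrable_1) (use h assms in \<open>auto simp: integrable_on_def\<close>)
  then show i: "integrable (lebesgue_on {0..2*pi}) (\<lambda>x. \<bar>x - c\<bar> powr (p - 1))"
    by (simp add: absolutely_integrable_measurable_real)
  have "(\<integral>x. \<bar>x - c\<bar> powr (p - 1) \<partial>lebesgue_on {0..2*pi}) =
     (max 0 (2*pi-c) powr p - max 0 (c-2*pi) powr p) / p - (max 0 (0-c) powr p - max 0 (c-0) powr p) / p"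
    using h assms by (subst lebesgue_integral_eq_integral[OF i]) (auto intro: integral_unique)
  also have "\<dots> \<le> (max 0 (2*pi-c) powr p) / p + (max 0 (c-0) powr p) / p"
    proof -
    have "(x - y) / p - (z - w) / p \<le> x / p + w / p" if "y \<ge> 0" "z \<ge> 0" for x y z w :: real
      using that assms by (simp add: divide_simps)
    then show ?thesis by simp
  qed
  also have "\<dots> \<le> 20 powr p / p + 20 powr p / p"
    using assms pi_approx by (intro add_mono divide_right_mono powr_mono2) auto
  finally show "(\<integral>x. \<bar>x - c\<bar> powr (p - 1) \<partial>lebesgue_on {0..2*pi}) \<le> 2 * 20 powr p / p" by simp
qed

text \<open>The power is dominated by the sum of the same powers of the distances to all zeros that
  can be nearest to some t in [0, 2 pi], and that sum has an integral bounded independently of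
  \<open>a\<close>.\<close>

lemma sin_powr_integral:
  fixes p :: real
  assumes "0 < p" "p < 1"
  obtains C where "C > 0"
    "\<And>a. \<bar>a\<bar> \<le> pi \<Longrightarrow> integrable (lebesgue_on {0..2*pi}) (\<lambda>t. \<bar>sin (t - a)\<bar> powr (p - 1))"
    "\<And>a. \<bar>a\<bar> \<le> pi \<Longrightarrow> (\<integral>t. \<bar>sin (t - a)\<bar> powr (p - 1) \<partial>lebesgue_on {0..2*pi}) \<le> C"
proof
  \<comment> \<open>As |a| \<le> pi, the quotient (t - a)/pi lies in [-1, 3], and so does its
    nearest integer; these five indices give the factor 5 in \<open>D\<close>.\<close>
  define K where "K = {-1..3::int}"
  define c where "c = (2/pi) powr (p - 1)"
  have c: "c > 0" by (simp add: c_def)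
  define D where "D = 5 * (c * (2 * 20 powr p / p))"
  show "D > 0" using c assms by (simp add: D_def)
  fix a :: real assume a: "\<bar>a\<bar> \<le> pi"
  define B where "B = (\<lambda>t. \<Sum>k\<in>K. c * \<bar>t - (a + of_int k * pi)\<bar> powr (p - 1))"
  have le: "\<bar>sin (t - a)\<bar> powr (p - 1) \<le> B t" if t: "t \<in> {0..2*pi}" for t
  proof -
    \<comment> \<open>\<open>v\<close> is the signed distance from t to the nearest zero a + k pi,
      so that |v| \<le> pi/2.\<close>
    define k where "k = round ((t-a)/pi)"
    define v where "v = t - a - k * pi"
    have "\<bar>(t-a)/pi - k\<bar> \<le> 1/2" unfolding k_def using of_int_round_abs_le[of "(t-a)/pi"] by (simp add: abs_minus_commute)
    then have v: "\<bar>v\<bar> \<le> pi/2"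
    proof -
      have "v = ((t-a)/pi - k) * pi" by (simp add: v_def field_simps)
      then have "\<bar>v\<bar> = \<bar>(t-a)/pi - k\<bar> * pi" by (simp add: abs_mult)
      also have "\<dots> \<le> 1/2 * pi" by (intro mult_right_mono) (use \<open>\<bar>(t-a)/pi - k\<bar> \<le> 1/2\<close> in auto)
      finally show ?thesis by simp
    qed
    have "(t-a)/pi \<ge> -1" "(t-a)/pi \<le> 3" using a t by (auto simp: field_simps)
    moreover have "\<bar>x - real_of_int k\<bar> \<le> 1/2 \<Longrightarrow> -1 \<le> x \<Longrightarrow> x \<le> 3 \<Longrightarrow> real_of_int (-2) < real_of_int k \<and> real_of_int k < real_of_int 4" for x
      by (simp add: abs_if split: if_splits)
    ultimately have "real_of_int (-2) < real_of_int k \<and> real_of_int k < real_of_int 4"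
      using \<open>\<bar>(t-a)/pi - k\<bar> \<le> 1/2\<close> by blast
    then have kK: "k \<in> K" unfolding of_int_less_iff by (simp add: K_def)
    have "sin (t - a) = sin (v + k * pi)" by (simp add: v_def)
    also have "\<bar>\<dots>\<bar> = \<bar>sin v\<bar>"
      by (simp add: sin_add abs_mult cos_int_times_real sin_int_times_real mult.commute[of "of_int k"])
    finally have s: "\<bar>sin (t - a)\<bar> = \<bar>sin v\<bar>" .
    \<comment> \<open>The exponent is negative, so Jordan's lower bound for the sine becomes an
      upper bound; at v = 0 both sides are 0 by convention.\<close>
    have "\<bar>sin v\<bar> powr (p - 1) \<le> c * \<bar>v\<bar> powr (p - 1)"
    proof (cases "v = 0")
      case False
      then have "\<bar>sin v\<bar> powr (p - 1) \<le> (2/pi * \<bar>v\<bar>) powr (p - 1)"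
        using assms abs_sin_ge[OF v] by (intro powr_mono2') auto
      then show ?thesis unfolding c_def by (subst (asm) powr_mult) auto
    qed (use c in auto)
    also have "\<dots> = c * \<bar>t - (a + of_int k * pi)\<bar> powr (p - 1)" by (simp add: v_def algebra_simps)
    also have "\<dots> \<le> B t" unfolding B_def
      by (rule member_le_sum[OF kK]) (use c in \<open>auto simp: K_def\<close>)
    finally show ?thesis by (simp add: s)
  qed
  have c13: "\<bar>a + of_int k * pi\<bar> \<le> 13" if "k \<in> K" for k
  proof -
    have "\<bar>a + of_int k * pi\<bar> \<le> \<bar>a\<bar> + \<bar>of_int k * pi\<bar>" by simp
    also have "\<bar>of_int k * pi\<bar> \<le> 3 * pi" unfolding abs_mult
      using that by (intro mult_mono) (auto simp: K_def)
    finally show ?thesis using a pi_approx by simp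
  qed
  have Bi: "integrable (lebesgue_on {0..2*pi}) B" unfolding B_def
    by (intro Bochner_Integration.integrable_sum integrable_mult_right integral_abs_powr_le(1) c13) (use assms in auto)
  have "(\<lambda>t. \<bar>sin (t - a)\<bar> powr (p - 1)) \<in> borel_measurable borel" by measurable
  then have m: "(\<lambda>t. \<bar>sin (t - a)\<bar> powr (p - 1)) \<in> borel_measurable (lebesgue_on {0..2*pi})"
    by (rule borel_measurable_lebesgue_on)
  have ae: "AE t in lebesgue_on {0..2*pi}. \<bar>sin (t - a)\<bar> powr (p - 1) \<le> B t"
    using le by (simp add: AE_restrict_space_iff)
  show i: "integrable (lebesgue_on {0..2*pi}) (\<lambda>t. \<bar>sin (t - a)\<bar> powr (p - 1))"
    by (rule Bochner_Integration.integrable_bound[OF Bi m]) (use ae in eventually_elim, auto)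
  have "(\<integral>t. \<bar>sin (t - a)\<bar> powr (p - 1) \<partial>lebesgue_on {0..2*pi}) \<le> (\<integral>t. B t \<partial>lebesgue_on {0..2*pi})"
    by (rule integral_mono_AE[OF i Bi ae])
  also have "\<dots> = (\<Sum>k\<in>K. c * (\<integral>t. \<bar>t - (a + of_int k * pi)\<bar> powr (p - 1) \<partial>lebesgue_on {0..2*pi}))"
    unfolding B_def using assms c13 by (subst Bochner_Integration.integral_sum) (auto intro!: integral_abs_powr_le(1))
  also have "\<dots> \<le> (\<Sum>k\<in>K. c * (2 * 20 powr p / p))"
    using c assms c13 by (intro sum_mono mult_left_mono integral_abs_powr_le(2)) auto
  also have "\<dots> = D" by (simp add: D_def K_def)
  finally show "(\<integral>t. \<bar>sin (t - a)\<bar> powr (p - 1) \<partial>lebesgue_on {0..2*pi}) \<le> D" .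
qed

subsection \<open>The logarithm of the distance to a point\<close>

text \<open>A line through the origin meets the circle in at most two points; they form the
  exceptional set for negative powers of the distance to that line.\<close>

lemma finite_circle_line:
  assumes "norm b = 1"
  shows "finite {z. norm z = r \<and> Im (z * b) = 0}"
proof -
  have "{z. norm z = r \<and> Im (z * b) = 0} \<subseteq> {of_real r * cnj b, - (of_real r * cnj b)}"
  proof
    fix z assume "z \<in> {z. norm z = r \<and> Im (z * b) = 0}"
    then have z: "norm z = r" "Im (z * b) = 0" by auto
    define x where "x = Re (z * b)"
    have zb: "z * b = of_real x" using z by (simp add: complex_eq_iff x_def)
    then have "norm (z * b) = \<bar>x\<bar>" by simp
    then have "x = r \<or> x = - r" using z assms by (simp add: norm_mult) linarith
    moreover have "z = of_real x * cnj b"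
    proof -
      have "z * b * cnj b = z" using assms complex_norm_square[of b] by (simp add: mult.assoc)
      then show ?thesis using zb by simp
    qed
    ultimately show "z \<in> {of_real r * cnj b, - (of_real r * cnj b)}" by auto
  qed
  then show ?thesis by (rule finite_subset) simp
qed

text \<open>|Im (z b)| is the distance from z to a line through the origin. On the circle it equals
  r |sin (t + Arg b)|, so the sine integral gives the constant and homogeneity the power of
  r.\<close>

lemma Im_circle_powr:
  fixes p :: real
  assumes "0 < p" "p < 1"
  obtains C where "C > 0"
    "\<And>r b. r > 0 \<Longrightarrow> norm (b::complex) = 1 \<Longrightarrow> circ_int r (\<lambda>z. \<bar>Im (z * b)\<bar> powr (p - 1))"
    "\<And>r b. r > 0 \<Longrightarrow> norm (b::complex) = 1 \<Longrightarrow> circ_mean r (\<lambda>z. \<bar>Im (z * b)\<bar> powr (p - 1)) \<le> C * r powr (p - 1)"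
proof -
  obtain C where C: "C > 0"
    "\<And>a. \<bar>a\<bar> \<le> pi \<Longrightarrow> integrable (lebesgue_on {0..2*pi}) (\<lambda>t. \<bar>sin (t - a)\<bar> powr (p - 1))"
    "\<And>a. \<bar>a\<bar> \<le> pi \<Longrightarrow> (\<integral>t. \<bar>sin (t - a)\<bar> powr (p - 1) \<partial>lebesgue_on {0..2*pi}) \<le> C"
    using sin_powr_integral[OF assms] by blast
  have eq: "\<bar>Im (of_real r * cis t * b)\<bar> powr (p - 1) = r powr (p - 1) * \<bar>sin (t - (- Arg b))\<bar> powr (p - 1)"
    if "r > 0" "norm b = 1" for r b t
  proof -
    have "b = cis (Arg b)" using that by (metis cis_Arg norm_zero sgn_eq zero_neq_one div_by_1 of_real_1)
    then have "of_real r * cis t * b = of_real r * cis (t + Arg b)" by (metis cis_mult mult.assoc)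
    then have "\<bar>Im (of_real r * cis t * b)\<bar> = r * \<bar>sin (t - (- Arg b))\<bar>"
      using that by (subst \<open>of_real r * cis t * b = _\<close>) (simp add: abs_mult)
    then show ?thesis using that by (simp add: powr_mult)
  qed
  have arg: "\<bar>- Arg b\<bar> \<le> pi" for b using Arg_bounded[of b] by auto
  show ?thesis
  proof (rule that[of "1 / (2*pi) * C"])
    fix r :: real and b :: complex assume rb: "r > 0" "norm b = 1"
    show "circ_int r (\<lambda>z. \<bar>Im (z * b)\<bar> powr (p - 1))"
      unfolding circ_int_def eq[OF rb] by (intro integrable_mult_right C(2) arg)
    have "circ_mean r (\<lambda>z. \<bar>Im (z * b)\<bar> powr (p - 1)) =
        1 / (2*pi) * (r powr (p - 1) * (\<integral>t. \<bar>sin (t - (- Arg b))\<bar> powr (p - 1) \<partial>lebesgue_on {0..2*pi}))"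
      unfolding circ_mean_def eq[OF rb] by simp
    also have "\<dots> \<le> 1 / (2*pi) * (r powr (p - 1) * C)"
      by (intro mult_left_mono C(3) arg) auto
    finally show "circ_mean r (\<lambda>z. \<bar>Im (z * b)\<bar> powr (p - 1)) \<le> 1 / (2*pi) * C * r powr (p - 1)"
      by (simp add: mult_ac)
  qed (use C in auto)
qed

text \<open>A point is at least as far from \<open>a\<close> as from the line through 0 and
  \<open>a\<close>. Comparing with that line removes all dependence on the position of
  \<open>a\<close>, even for \<open>a\<close> on the circle.\<close>

lemma circ_dist_powr:
  fixes p :: real
  assumes "0 < p" "p < 1"
  obtains C where "C > 0"
    "\<And>r a. r > 0 \<Longrightarrow> circ_int r (\<lambda>z. norm (z - a) powr (p - 1))"
    "\<And>r a. r > 0 \<Longrightarrow> circ_mean r (\<lambda>z. norm (z - a) powr (p - 1)) \<le> C * r powr (p - 1)"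
proof -
  obtain C where C: "C > 0"
    "\<And>r b. r > 0 \<Longrightarrow> norm (b::complex) = 1 \<Longrightarrow> circ_int r (\<lambda>z. \<bar>Im (z * b)\<bar> powr (p - 1))"
    "\<And>r b. r > 0 \<Longrightarrow> norm (b::complex) = 1 \<Longrightarrow> circ_mean r (\<lambda>z. \<bar>Im (z * b)\<bar> powr (p - 1)) \<le> C * r powr (p - 1)"
    using Im_circle_powr[OF assms] by blast
  show ?thesis
  proof (rule that[OF C(1)])
    fix r :: real and a :: complex assume r: "r > 0"
    \<comment> \<open>The rotation that takes \<open>a\<close> to the nonnegative real axis, so that
      Im (z b) = Im ((z - a) b).\<close>
    define b where "b = cnj (cis (Arg a))"
    have b: "norm b = 1" by (simp add: b_def)
    have "a * b = of_real (norm a)"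
    proof -
      have "a = of_real (norm a) * cis (Arg a)" by (metis rcis_cmod_Arg rcis_def)
      then have "a * b = of_real (norm a) * (cis (Arg a) * cnj (cis (Arg a)))" unfolding b_def by (metis mult.assoc)
      then show ?thesis by (simp add: cis_cnj cis_mult)
    qed
    then have Im: "\<bar>Im (z * b)\<bar> \<le> norm (z - a)" for z
    proof -
      have "Im (z * b) = Im ((z - a) * b)" using \<open>a * b = of_real (norm a)\<close> by (simp add: left_diff_distrib del: times_complex.sel)
      also have "\<bar>\<dots>\<bar> \<le> norm ((z - a) * b)" by (rule abs_Im_le_cmod)
      finally show ?thesis using b by (simp add: norm_mult)
    qed
    let ?F = "{z. norm z = r \<and> Im (z * b) = 0}"
    have le: "norm (z - a) powr (p - 1) \<le> \<bar>Im (z * b)\<bar> powr (p - 1)" if "norm z = r" "z \<notin> ?F" for z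
      using that Im[of z] assms by (intro powr_mono2') auto
    show i: "circ_int r (\<lambda>z. norm (z - a) powr (p - 1))"
      by (rule circ_int_bound[OF C(2)[OF r b] r finite_circle_line[OF b, of r]]) (use le in \<open>auto\<close>)
    show "circ_mean r (\<lambda>z. norm (z - a) powr (p - 1)) \<le> C * r powr (p - 1)"
      using circ_mean_mono[OF r finite_circle_line[OF b, of r] i C(2)[OF r b] le] C(3)[OF r b] by simp
  qed
qed

text \<open>Reduces integrability of the logarithm to that of an inverse square root; the exponent
  is left as \<open>1/2 - 1\<close> to fit the shape \<open>p - 1\<close> used above.\<close>

lemma abs_ln_le:
  fixes x :: real
  assumes "x > 0"
  shows "\<bar>ln x\<bar> \<le> x + 2 * x powr (1/2 - 1)"
proof -
  have 1: "ln x \<le> x" using ln_le_minus_one[OF assms] by simp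
  have "ln (1 / x powr (1/2)) \<le> 1 / x powr (1/2)" using ln_le_minus_one[of "1 / x powr (1/2)"] assms by simp
  then have "- (1/2) * ln x \<le> x powr (-(1/2))" using assms by (simp add: ln_div ln_powr powr_minus_divide)
  then have 2: "- ln x \<le> 2 * x powr (1/2 - 1)" by simp
  show ?thesis using 1 2 assms powr_ge_zero[of x "1/2 - 1"] unfolding abs_le_iff by linarith
qed

lemma circ_int_ln_dist:
  assumes "r > 0"
  shows "circ_int r (\<lambda>z. ln (norm (z - a)))"
proof -
  have "circ_int r (\<lambda>z. norm (z - a) powr (1/2 - 1))"
    by (rule circ_dist_powr[of "1/2"]) (use assms in auto)
  moreover have "circ_int r (\<lambda>z. norm (z - a))" by (intro circ_int_continuous continuous_intros)
  ultimately have "circ_int r (\<lambda>z. norm (z - a) + 2 * norm (z - a) powr (1/2 - 1))"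
    by (intro circ_int_add circ_int_cmult)
  then show ?thesis
    by (rule circ_int_bound[OF _ assms, of _ "{a}"]) (use abs_ln_le in auto)
qed

section \<open>Mean value property, the mean of log |z - a|, and a derivative bound through the real
  part\<close>

lemma circ_mean_Re_holomorphic:
  assumes "h holomorphic_on ball 0 S" "0 < r" "r < S"
  shows "circ_int r (\<lambda>z. Re (h z))" "circ_mean r (\<lambda>z. Re (h z)) = Re (h 0)"
proof -
  have hol: "h holomorphic_on cball 0 r" using assms by (auto intro: holomorphic_on_subset)
  then have cont: "continuous_on (cball 0 r) h" by (rule holomorphic_on_imp_continuous_on)
  show i: "circ_int r (\<lambda>z. Re (h z))"
    using assms by (intro circ_int_continuous continuous_intros continuous_on_subset[OF cont]) auto
  have "((\<lambda>u. h u/(u-0)) has_contour_integral (2 * of_real pi * \<i> * h 0)) (circlepath 0 r)"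
    by (rule Cauchy_integral_circlepath_simple[OF hol]) (use assms in auto)
  then have "((\<lambda>t. h (of_real r * cis t) / (of_real r * cis t) * of_real r * \<i> * cis t) has_integral 2 * of_real pi * \<i> * h 0) {0..2*pi}"
    unfolding circlepath_def by (subst (asm) has_contour_integral_part_circlepath_iff) auto
  then have "((\<lambda>t. h (of_real r * cis t) * \<i>) has_integral 2 * of_real pi * \<i> * h 0) {0..2*pi}"
    by (rule has_integral_eq[rotated]) (use assms in \<open>auto simp: field_simps\<close>)
  \<comment> \<open>The factor i left over from the differential of the circle turns the real part
    of h into an imaginary part.\<close>
  then have "((\<lambda>t. Im (h (of_real r * cis t) * \<i>)) has_integral Im (2 * of_real pi * \<i> * h 0)) {0..2*pi}"
    by (rule has_integral_Im)
  then have "((\<lambda>t. Re (h (of_real r * cis t))) has_integral 2 * pi * Re (h 0)) {0..2*pi}" by simp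
  then show "circ_mean r (\<lambda>z. Re (h z)) = Re (h 0)"
    using i by (simp add: circ_mean_integral integral_unique)
qed

text \<open>For |b| < 1 the function log(1 - bz/r) has a holomorphic branch on a disc of radius
  greater than r, with value 0 at the origin. For |b| = 1 the zero lies on the circle itself, and
  dominated convergence along c(n) b with c(n) tending to 1 gives the claim.\<close>

lemma circ_mean_ln_one_minus:
  assumes r: "r > 0" and b: "norm b \<le> 1"
  shows "circ_int r (\<lambda>z. ln (norm (1 - b * z / of_real r)))"
    "circ_mean r (\<lambda>z. ln (norm (1 - b * z / of_real r))) = 0"
proof -
  show int: "circ_int r (\<lambda>z. ln (norm (1 - b * z / of_real r)))"
  proof (cases "b = 0")
    case False
    have "circ_int r (\<lambda>z. ln (norm b / r) + ln (norm (z - of_real r / b)))"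
      by (intro circ_int_add circ_int_const circ_int_ln_dist r)
    then show ?thesis
    proof (rule circ_int_bound[OF circ_int_abs r, of _ "{of_real r / b}"])
      fix z assume "z \<notin> {of_real r / b}"
      then have "z - of_real r / b \<noteq> 0" by auto
      have "norm (1 - b * z / of_real r) = norm (- (b / of_real r) * (z - of_real r / b))"
        using r False by (intro arg_cong[of _ _ norm]) (simp add: field_simps)
      also have "\<dots> = norm b / r * norm (z - of_real r / b)"
        using r unfolding norm_mult norm_minus_cancel norm_divide by simp
      finally have "ln (norm (1 - b * z / of_real r)) = ln (norm b / r) + ln (norm (z - of_real r / b))"
        using r False \<open>z - of_real r / b \<noteq> 0\<close> by (simp only:) (subst ln_mult, auto)
      then show "\<bar>ln (norm (1 - b * z / of_real r))\<bar> \<le> \<bar>ln (norm b / r) + ln (norm (z - of_real r / b))\<bar>" by simp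
    qed auto
  qed auto
  have lt: "circ_mean r (\<lambda>z. ln (norm (1 - b * z / of_real r))) = 0" if b: "norm b < 1" for b
  proof -
    \<comment> \<open>For nonzero b this is the harmonic mean of r and r/|b|: it exceeds r, yet
      |bz/r| < 1 on the ball.\<close>
    define S where "S = 2 * r / (1 + norm b)"
    have S: "r < S"
    proof -
      have "r * (1 + norm b) < r * 2" using r b by (intro mult_strict_left_mono) auto
      moreover have "1 + norm b > 0" by (rule add_pos_nonneg) auto
      ultimately show ?thesis by (simp add: S_def pos_less_divide_eq mult.commute)
    qed
    have pos: "norm (b * z / of_real r) < 1" if "z \<in> ball 0 S" for z
    proof -
      have "norm (b * z / of_real r) = norm b * norm z / r" using r by (simp add: norm_mult norm_divide)
      also have "\<dots> \<le> norm b * S / r" using that r by (intro divide_right_mono mult_left_mono) auto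
      also have "\<dots> = 2 * norm b / (1 + norm b)" using r by (simp add: S_def)
      also have "\<dots> < 1"
      proof -
        have "1 + norm b > 0" by (rule add_pos_nonneg) auto
        then show ?thesis using b by (simp add: pos_divide_less_eq)
      qed
      finally show ?thesis .
    qed
    have nn: "1 - b * z / of_real r \<notin> \<real>\<^sub>\<le>\<^sub>0" if "z \<in> ball 0 S" for z
    proof -
      have "Re (b * z / of_real r) < 1" using pos[OF that] complex_Re_le_cmod[of "b * z / of_real r"] by linarith
      then show ?thesis by (auto simp: complex_nonpos_Reals_iff)
    qed
    have "(\<lambda>z. Ln (1 - b * z / of_real r)) holomorphic_on ball 0 S"
      using nn r by (intro holomorphic_intros) auto
    from circ_mean_Re_holomorphic[OF this r S]
    have "circ_int r (\<lambda>z. Re (Ln (1 - b * z / of_real r)))" "circ_mean r (\<lambda>z. Re (Ln (1 - b * z / of_real r))) = 0" by auto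
    moreover have "Re (Ln (1 - b * z / of_real r)) = ln (norm (1 - b * z / of_real r))" if "norm z = r" for z
      using nn[of z] S that by (subst Re_Ln) (auto)
    ultimately show ?thesis
      using circ_mean_cong_sphere[OF r, of "\<lambda>z. Re (Ln (1 - b * z / of_real r))"] by simp
  qed
  show "circ_mean r (\<lambda>z. ln (norm (1 - b * z / of_real r))) = 0"
  proof (cases "norm b < 1")
    case False
    then have b1: "norm b = 1" using b by simp
    \<comment> \<open>The shift by 2 keeps c(n) \<ge> 1/2, so that one dominating function serves
      all n.\<close>
    define c where "c = (\<lambda>n. 1 - 1 / real (n + 2))"
    have c: "1/2 \<le> c n" "c n < 1" for n by (auto simp: c_def field_simps)
    define f where "f = (\<lambda>n z. ln (norm (1 - (of_real (c n) * b) * z / of_real r)))"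
    \<comment> \<open>The modulus of 1 - c(n) bz/r is at least |Im (z b)|/(2r), by c(n) \<ge> 1/2,
      and at most 2; \<open>abs_ln_le\<close> turns these two bounds into \<open>v\<close>.\<close>
    define v where "v = (\<lambda>z. 2 + 2 * ((1 / (2*r)) powr (1/2 - 1) * \<bar>Im (z * b)\<bar> powr (1/2 - 1)))"
    have iv: "circ_int r v" unfolding v_def
      by (rule Im_circle_powr[of "1/2"]) (use r b1 in \<open>auto intro!: circ_int_add circ_int_cmult\<close>)
    let ?F = "{z. norm z = r \<and> Im (z * b) = 0}"
    have fin: "finite ?F" by (rule finite_circle_line[OF b1])
    have bound: "\<bar>f n z\<bar> \<le> v z" if z: "norm z = r" "z \<notin> ?F" for n z
    proof -
      have nz: "\<bar>Im (z * b)\<bar> > 0" using z by auto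
      let ?x = "norm (1 - (of_real (c n) * b) * z / of_real r)"
      have "\<bar>Im (1 - (of_real (c n) * b) * z / of_real r)\<bar> = c n / r * \<bar>Im (z * b)\<bar>"
      proof -
        have "(of_real (c n) * b) * z / of_real r = of_real (c n / r) * (z * b)" by simp
        then have "Im (1 - (of_real (c n) * b) * z / of_real r) = - (c n / r * Im (z * b))"
          by (simp only: minus_complex.sel one_complex.sel) (simp add: distrib_left add_divide_distrib)

        then show ?thesis using c[of n] r by (simp add: abs_mult del: times_complex.sel)
      qed
      then have "c n / r * \<bar>Im (z * b)\<bar> \<le> ?x" using abs_Im_le_cmod[of "1 - (of_real (c n) * b) * z / of_real r"] by simp
      moreover have "1 / (2 * r) * \<bar>Im (z * b)\<bar> \<le> c n / r * \<bar>Im (z * b)\<bar>"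
        using c[of n] r by (intro mult_right_mono) (auto simp: field_simps)
      ultimately have x: "1 / (2*r) * \<bar>Im (z * b)\<bar> \<le> ?x" by linarith
      moreover have p: "1 / (2*r) * \<bar>Im (z * b)\<bar> > 0" using r nz by simp
      ultimately have "?x > 0" by linarith
      have "?x \<le> 1 + norm ((of_real (c n) * b) * z / of_real r)" by (metis norm_triangle_ineq4 norm_one)
      also have "\<dots> \<le> 2" using b1 z r c[of n] by (simp add: norm_mult norm_divide)
      finally have x2: "?x \<le> 2" .
      have "\<bar>f n z\<bar> \<le> ?x + 2 * ?x powr (1/2 - 1)" unfolding f_def by (rule abs_ln_le[OF \<open>?x > 0\<close>])
      also have "\<dots> \<le> 2 + 2 * (1 / (2*r) * \<bar>Im (z * b)\<bar>) powr (1/2 - 1)"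
        using x p x2 by (intro add_mono mult_left_mono powr_mono2') auto
      also have "\<dots> = v z" unfolding v_def by (subst powr_mult) (use r in auto)
      finally show ?thesis .
    qed
    have "(\<lambda>n. \<integral>t. f n (of_real r * cis t) \<partial>lebesgue_on {0..2*pi}) \<longlonglongrightarrow>
        (\<integral>t. ln (norm (1 - b * (of_real r * cis t) / of_real r)) \<partial>lebesgue_on {0..2*pi})"
    proof (rule integral_dominated_convergence[where w="\<lambda>t. v (of_real r * cis t)"])
      show "(\<lambda>t. ln (norm (1 - b * (of_real r * cis t) / of_real r))) \<in> borel_measurable (lebesgue_on {0..2*pi})"
        by (rule measurable_circle[where u="\<lambda>z. ln (norm (1 - b * z / of_real r))"]) measurable
      show "(\<lambda>t. f n (of_real r * cis t)) \<in> borel_measurable (lebesgue_on {0..2*pi})" for n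
        unfolding f_def by (rule measurable_circle[where u="\<lambda>z. ln (norm (1 - of_real (c n) * b * z / of_real r))"]) measurable
      show "AE t in lebesgue_on {0..2*pi}. norm (f n (of_real r * cis t)) \<le> v (of_real r * cis t)" for n
        by (rule AE_circle[OF r fin, where P="\<lambda>z. norm (f n z) \<le> v z"]) (use bound in auto)
      show "AE t in lebesgue_on {0..2*pi}. (\<lambda>n. f n (of_real r * cis t)) \<longlonglongrightarrow> ln (norm (1 - b * (of_real r * cis t) / of_real r))"
      proof (rule AE_circle[OF r fin, where P="\<lambda>z. (\<lambda>n. f n z) \<longlonglongrightarrow> ln (norm (1 - b * z / of_real r))"])
        fix z assume z: "norm z = r" "z \<notin> ?F"
        have cl: "c \<longlonglongrightarrow> 1" unfolding c_def by real_asymp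
        have "1 - (of_real (1::real) * b) * z / of_real r \<noteq> 0"
        proof
          assume "1 - (of_real 1 * b) * z / of_real r = 0"
          then have "z * b = of_real r" using r by (simp add: field_simps)
          then show False using z by (simp del: times_complex.sel)
        qed
        then have "(\<lambda>n. f n z) \<longlonglongrightarrow> ln (norm (1 - (of_real 1 * b) * z / of_real r))"
          unfolding f_def using cl r by (intro tendsto_intros) auto
        then show "(\<lambda>n. f n z) \<longlonglongrightarrow> ln (norm (1 - b * z / of_real r))" by simp
      qed
      show "integrable (lebesgue_on {0..2*pi}) (\<lambda>t. v (of_real r * cis t))" using iv by (simp add: circ_int_def)
    qed
    then have "(\<lambda>n. circ_mean r (f n)) \<longlonglongrightarrow> circ_mean r (\<lambda>z. ln (norm (1 - b * z / of_real r)))"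
      unfolding circ_mean_def by (intro tendsto_intros)
    moreover have "circ_mean r (f n) = 0" for n unfolding f_def
      by (rule lt) (use c[of n] b1 in \<open>auto simp: norm_mult\<close>)
    ultimately show ?thesis by (simp add: LIMSEQ_const_iff)
  qed (use lt in auto)
qed

text \<open>In both cases |z - a| = s |1 - bz/r| on the circle, with s = max(r, |a|) and |b| \<le>
  1. For |a| \<ge> r, factoring out a gives b = r/a; for |a| < r, reflection in the circle gives b =
  conj(a)/r.\<close>

lemma circ_mean_ln_dist:
  assumes r: "r > 0"
  shows "circ_mean r (\<lambda>z. ln (norm (z - a))) = ln (max r (norm a))"
proof -
  have *: "circ_mean r (\<lambda>z. ln (norm (z - a))) = ln s"
    if s: "s > 0" and b: "norm b \<le> 1" and eq: "\<And>z. norm z = r \<Longrightarrow> norm (z - a) = s * norm (1 - b * z / of_real r)" for s b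
  proof -
    note i = circ_mean_ln_one_minus[OF r b]
    have "circ_mean r (\<lambda>z. ln (norm (z - a))) = circ_mean r (\<lambda>z. ln s + ln (norm (1 - b * z / of_real r)))"
    proof (rule circ_mean_cong[OF r, of "{a}"])
      fix z assume z: "norm z = r" "z \<notin> {a}"
      then have "1 - b * z / of_real r \<noteq> 0" using eq[OF z(1)] by auto
      then show "ln (norm (z - a)) = ln s + ln (norm (1 - b * z / of_real r))"
        using eq[OF z(1)] s by (simp add: ln_mult)
    qed (auto intro!: circ_int_ln_dist i r)
    also have "\<dots> = ln s" by (subst circ_mean_add) (use i in auto)
    finally show ?thesis .
  qed
  show ?thesis
  proof (cases "norm a \<ge> r")
    case True
    then have a: "a \<noteq> 0" using r by auto
    have "circ_mean r (\<lambda>z. ln (norm (z - a))) = ln (norm a)"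
    proof (rule *[of _ "of_real r / a"])
      fix z
      have "norm (z - a) = norm (- a * (1 - of_real r / a * z / of_real r))"
        using a r by (intro arg_cong[of _ _ norm]) (simp add: field_simps)
      then show "norm (z - a) = norm a * norm (1 - of_real r / a * z / of_real r)" by (simp only: norm_mult norm_minus_cancel)
    qed (use a True r in \<open>auto simp: norm_divide\<close>)
    then show ?thesis using True by simp
  next
    case False
    have "circ_mean r (\<lambda>z. ln (norm (z - a))) = ln r"
    proof (rule *[of _ "cnj a / of_real r"])
      fix z :: complex assume z: "norm z = r"
      have "r * norm (z - a) = norm (cnj z * (z - a))" using z by (simp add: norm_mult)
      also have "cnj z * (z - a) = of_real (r^2) * cnj (1 - cnj a / of_real r * z / of_real r)"
        using z r complex_norm_square[of z] by (simp add: field_simps power2_eq_square)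
      also have "norm \<dots> = r^2 * norm (1 - cnj a / of_real r * z / of_real r)"
        unfolding norm_mult complex_mod_cnj norm_of_real by simp
      finally show "norm (z - a) = r * norm (1 - cnj a / of_real r * z / of_real r)"
        using r by (simp add: power2_eq_square)
    qed (use False r in \<open>auto simp: norm_divide\<close>)
    then show ?thesis using False by simp
  qed
qed

text \<open>Im h is not controlled by |f|, so the usual Cauchy estimate for h' is of no use here.
  The factor 2 comes from h + conj(h), and R/(R - |z|)^2 bounds the Cauchy kernel.\<close>

lemma norm_deriv_le_circ_mean_Re:
  assumes hol: "h holomorphic_on ball 0 S" and "0 < R" "R < S" and z: "norm z < R"
  shows "norm (deriv h z) \<le> 2 * R / (R - norm z)^2 * circ_mean R (\<lambda>w. \<bar>Re (h w)\<bar>)"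
proof -
  have holc: "h holomorphic_on cball 0 R" using hol by (rule holomorphic_on_subset) (use assms in auto)
  then have cont: "continuous_on (cball 0 R) h" by (rule holomorphic_on_imp_continuous_on)
  define K where "K = (\<lambda>t. of_real R * \<i> * cis t / (of_real R * cis t - z)^2)"
  have ne: "of_real R * cis t \<noteq> z" for t using z assms by (auto simp: norm_mult)
  have "((\<lambda>u. h u / (u - z) ^ Suc 1) has_contour_integral 2 * pi * \<i> / fact 1 * (deriv ^^ 1) h z) (circlepath 0 R)"
    by (rule Cauchy_has_contour_integral_higher_derivative_circlepath[OF cont])
       (use z holc in \<open>auto intro: holomorphic_on_subset\<close>)
  then have "((\<lambda>t. h (of_real R * cis t) / (of_real R * cis t - z)^2 * R * \<i> * cis t) has_integral 2 * pi * \<i> * deriv h z) {0..2*pi}"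
    unfolding circlepath_def by (subst (asm) has_contour_integral_part_circlepath_iff) (auto simp: power2_eq_square)
  then have 1: "((\<lambda>t. h (of_real R * cis t) * K t) has_integral 2 * pi * \<i> * deriv h z) {0..2*pi}"
    by (rule has_integral_eq[rotated]) (simp add: K_def mult_ac)
  txt \<open>The conjugate of $h$ contributes nothing to Cauchy's formula for $h'$, as on the circle
    $\bar\zeta = R^2/\zeta$; this replaces $h$ by $2\,\mathrm{Re}\,h$.\<close>
  have nz: "of_real R ^ 2 - cnj z * u \<noteq> 0" if "u \<in> cball 0 R" for u
  proof
    assume "of_real R ^ 2 - cnj z * u = 0"
    then have "norm (cnj z * u) = norm (complex_of_real R ^ 2)" by simp
    then have "norm z * norm u = R * R" by (simp add: norm_mult norm_power power2_eq_square)
    moreover have "norm z * norm u \<le> norm z * R" using that by (intro mult_left_mono) auto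
    moreover have "norm z * R < R * R" using z assms by (intro mult_strict_right_mono) auto
    ultimately show False by linarith
  qed
  \<comment> \<open>The kernel is built so that on the circle its conjugate, taken together with
    that of the differential, is -\<open>K\<close>. A singularity could only be at R^2/conj(z),
    outside the closed disc.\<close>
  have "((\<lambda>u. h u * of_real R ^ 2 / (of_real R ^ 2 - cnj z * u)^2) has_contour_integral 0) (circlepath 0 R)"
    by (rule Cauchy_theorem_convex_simple[of _ "cball 0 R"])
       (use nz assms holc in \<open>auto intro!: holomorphic_intros\<close>)
  then have "((\<lambda>t. h (of_real R * cis t) * of_real R ^ 2 / (of_real R ^ 2 - cnj z * (of_real R * cis t))^2 * R * \<i> * cis t) has_integral 0) {0..2*pi}"
    unfolding circlepath_def by (subst (asm) has_contour_integral_part_circlepath_iff) auto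
  then have "((cnj \<circ> (\<lambda>t. h (of_real R * cis t) * of_real R ^ 2 / (of_real R ^ 2 - cnj z * (of_real R * cis t))^2 * R * \<i> * cis t)) has_integral cnj 0) {0..2*pi}"
    by (subst has_integral_cnj)
  then have "((cnj \<circ> (\<lambda>t. h (of_real R * cis t) * of_real R ^ 2 / (of_real R ^ 2 - cnj z * (of_real R * cis t))^2 * R * \<i> * cis t)) has_integral 0) {0..2*pi}"
    by simp
  then have "((\<lambda>t. - (cnj (h (of_real R * cis t)) * K t)) has_integral 0) {0..2*pi}"
  proof (rule has_integral_eq[rotated], goal_cases)
    case (1 t)
    let ?c = "cis t"
    have cc: "cnj ?c * ?c = 1" by (simp add: cis_cnj cis_mult)
    have "of_real R ^ 2 - z * (of_real R * cnj ?c) = of_real R * cnj ?c * (of_real R * ?c - z)"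
      using cc by (simp add: algebra_simps power2_eq_square)
    then have "cnj (h (of_real R * ?c) * of_real R ^ 2 / (of_real R ^ 2 - cnj z * (of_real R * ?c))^2 * R * \<i> * ?c)
       = - (cnj (h (of_real R * ?c)) * of_real R ^ 2 / (of_real R * cnj ?c * (of_real R * ?c - z))^2 * R * \<i> * cnj ?c)"
      by simp
    also have "\<dots> = - (cnj (h (of_real R * ?c)) * (of_real R ^ 2 * R * \<i> * cnj ?c / (of_real R * cnj ?c * (of_real R * ?c - z))^2))"
      by simp
    also have "of_real R ^ 2 * R * \<i> * cnj ?c / (of_real R * cnj ?c * (of_real R * ?c - z))^2 = K t"
    proof -
      have "cnj ?c \<noteq> 0" by simp
      then have "of_real R ^ 2 * R * \<i> * cnj ?c / (of_real R * cnj ?c * (of_real R * ?c - z))^2 = R * \<i> / (cnj ?c * (of_real R * ?c - z)^2)"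
      proof -
        have "r ^ 2 * r * \<i> * a / (r * a * D)^2 = r * \<i> / (a * D^2)" if "r \<noteq> 0" "a \<noteq> 0" "D \<noteq> 0" for r a D :: complex
          using that by (simp add: field_simps power2_eq_square)
        then show ?thesis using assms ne[of t] \<open>cnj ?c \<noteq> 0\<close> by simp
      qed
      also have "\<dots> = R * \<i> * ?c / ((cnj ?c * ?c) * (of_real R * ?c - z)^2)"
        by simp
      finally show ?thesis by (simp add: K_def cc)
    qed
    finally show ?case by (simp add: o_def)
  qed
  then have 2: "((\<lambda>t. cnj (h (of_real R * cis t)) * K t) has_integral 0) {0..2*pi}"
    by (simp only: has_integral_neg_iff minus_zero)
  have 3: "((\<lambda>t. of_real (2 * Re (h (of_real R * cis t))) * K t) has_integral 2 * pi * \<i> * deriv h z) {0..2*pi}"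
    using has_integral_add[OF 1 2] by (simp add: distrib_right[symmetric] complex_add_cnj)
  have ci: "circ_int R (\<lambda>w. \<bar>Re (h w)\<bar>)"
    using assms by (intro circ_int_abs circ_mean_Re_holomorphic(1)[OF hol])
  define M where "M = R / (R - norm z)^2"
  have "norm (integral {0..2*pi} (\<lambda>t. of_real (2 * Re (h (of_real R * cis t))) * K t)) \<le>
        integral {0..2*pi} (\<lambda>t. 2 * M * \<bar>Re (h (of_real R * cis t))\<bar>)"
  proof (rule integral_norm_bound_integral)
    show "(\<lambda>t. 2 * M * \<bar>Re (h (of_real R * cis t))\<bar>) integrable_on {0..2*pi}"
      using ci by (intro integrable_on_cmult_left integrable_on_lebesgue_on) (auto simp: circ_int_def)
    fix t assume "t \<in> {0..2*pi}"
    have "norm (K t) = R / norm (of_real R * cis t - z)^2"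
      using assms by (simp add: K_def norm_mult norm_divide norm_power)
    also have "\<dots> \<le> M" unfolding M_def
    proof (intro divide_left_mono power_mono)
      show "R - norm z \<le> norm (of_real R * cis t - z)"
        using norm_triangle_ineq2[of "of_real R * cis t" z] assms by (simp add: norm_mult)
    qed (use ne[of t] assms in auto)
    finally have "norm (K t) * \<bar>Re (h (of_real R * cis t))\<bar> \<le> M * \<bar>Re (h (of_real R * cis t))\<bar>"
      by (rule mult_right_mono) simp
    then show "norm (of_real (2 * Re (h (of_real R * cis t))) * K t) \<le> 2 * M * \<bar>Re (h (of_real R * cis t))\<bar>"
      by (simp add: norm_mult abs_mult mult_ac)
  qed (use 3 in \<open>auto simp: integrable_on_def\<close>)
  then have "norm (2 * pi * \<i> * deriv h z) \<le> 2 * M * integral {0..2*pi} (\<lambda>t. \<bar>Re (h (of_real R * cis t))\<bar>)"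
    using 3 by (simp add: integral_unique)
  also have "\<dots> = 2 * pi * (2 * M * circ_mean R (\<lambda>w. \<bar>Re (h w)\<bar>))"
    using ci by (simp add: circ_mean_integral)
  finally have "2 * pi * norm (deriv h z) \<le> 2 * pi * (2 * M * circ_mean R (\<lambda>w. \<bar>Re (h w)\<bar>))"
    by (simp add: norm_mult)
  then have "norm (deriv h z) \<le> 2 * M * circ_mean R (\<lambda>w. \<bar>Re (h w)\<bar>)"
    by (rule mult_left_le_imp_le) simp
  then show ?thesis by (simp add: M_def)
qed

subsection \<open>Local factorisation of meromorphic functions\<close>

text \<open>\<open>Z\<close> contains all points of nonzero order in the ball and may contain points
  of order 0 where f merely has a wrong value; these have exponent 0 in the product and drop out of
  every sum weighted by orders. \<open>nonzero\<close> excludes functions vanishing identically, for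
  which orders have no meaning.\<close>

locale meromorphic_factorization =
  fixes f h :: "complex \<Rightarrow> complex" and Z :: "complex set" and S :: real
  assumes mero: "f meromorphic_on UNIV"
    and nonzero: "\<And>z. eventually (\<lambda>w. f w \<noteq> 0) (at z)"
    and finite_Z: "finite Z" and Z_subset: "Z \<subseteq> ball 0 S"
    and holomorphic_h: "h holomorphic_on ball 0 S"
    and zorder_nonzero: "\<And>c. c \<in> ball 0 S \<Longrightarrow> zorder f c \<noteq> 0 \<Longrightarrow> c \<in> Z"
    and factorization: "\<And>z. z \<in> ball 0 S \<Longrightarrow> z \<notin> Z \<Longrightarrow> f z = exp (h z) * (\<Prod>c\<in>Z. (z - c) powi zorder f c)"

lemma is_pole_iff_zorder_neg:
  assumes "f meromorphic_on {z}" "eventually (\<lambda>w. f w \<noteq> 0) (at z)"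
  shows "is_pole f z \<longleftrightarrow> zorder f z < 0"
  using assms isolated_pole_imp_neg_zorder zorder_neg_imp_is_pole meromorphic_at_iff by blast

text \<open>Order 0 excludes both a pole and the limit 0. The value of f at z itself is
  unconstrained, hence the passage to \<open>remove_sings\<close>.\<close>

lemma zorder_eq_0_remove_sings:
  assumes f: "f meromorphic_on {z}" "eventually (\<lambda>w. f w \<noteq> 0) (at z)" and "zorder f z = 0"
  shows "remove_sings f analytic_on {z}" "remove_sings f z \<noteq> 0"
proof -
  have np: "\<not> is_pole f z" using is_pole_iff_zorder_neg[OF f] assms by simp
  then obtain c where c: "f \<midarrow>z\<rightarrow> c" using f(1) by (auto simp: meromorphic_at_iff not_essential_def)
  then show "remove_sings f analytic_on {z}"
    using f(1) by (intro remove_sings_analytic_at) (auto simp: meromorphic_at_iff)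
  have "\<not> isolated_zero f z" using zorder_isolated_zero_pos' f assms(3) by (force simp: meromorphic_at_iff)
  then have "\<not> f \<midarrow>z\<rightarrow> 0" using f(2) by (simp add: isolated_zero_def)
  then show "remove_sings f z \<noteq> 0"
    using np f(1) by (subst remove_sings_eq_0_iff) (auto simp: meromorphic_at_iff)
qed

text \<open>Multiplying f by \<open>Q\<close>, which carries the opposite orders, leaves order 0 at
  every point of the ball. Once its removable singularities are filled in, the product is
  holomorphic without zeros on a disc, hence an exponential.\<close>

lemma meromorphic_factorization_exists:
  assumes mero: "f meromorphic_on UNIV" and nonzero: "\<And>z. eventually (\<lambda>w. f w \<noteq> 0) (at z)"
  obtains h Z where "meromorphic_factorization f h Z S"
proof -
  define B where "B = {z. \<not> (f analytic_on {z} \<and> f z \<noteq> 0)}"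
  have meroz: "f meromorphic_on A" for A using mero by (rule meromorphic_on_subset) simp
  have "eventually (\<lambda>z. f analytic_on {z}) (cosparse UNIV)"
    using mero by (rule meromorphic_on_imp_analytic_cosparse)
  moreover have "eventually (\<lambda>z. f z \<noteq> 0) (cosparse UNIV)"
    using nonzero by (simp add: eventually_cosparse_open_eq)
  ultimately have "eventually (\<lambda>z. f analytic_on {z} \<and> f z \<noteq> 0) (cosparse UNIV)" by (rule eventually_conj)
  then have "B sparse_in UNIV" by (simp add: eventually_cosparse B_def)
  then have "finite (cball 0 S \<inter> B)"
    by (intro sparse_in_compact_finite) (auto intro: sparse_in_subset)
  define Z where "Z = ball 0 S \<inter> B"
  have finZ: "finite Z" using \<open>finite (cball 0 S \<inter> B)\<close> by (rule rev_finite_subset) (auto simp: Z_def)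
  have notZ: "f analytic_on {z}" "f z \<noteq> 0" if "z \<in> ball 0 S" "z \<notin> Z" for z
    using that by (auto simp: Z_def B_def)
  have zero_order: "zorder f z = 0" if "z \<in> ball 0 S" "z \<notin> Z" for z
    using notZ[OF that] by (rule zorder_eq_0I)
  define Q where "Q = (\<lambda>z. \<Prod>c\<in>Z. (z - c) powi (- zorder f c))"
  define F where "F = (\<lambda>z. f z * Q z)"
  have Qmero: "Q meromorphic_on A" for A unfolding Q_def by (intro meromorphic_intros)
  have Fmero: "F meromorphic_on A" for A unfolding F_def by (intro meromorphic_intros meroz Qmero)
  have ne: "eventually (\<lambda>w. w \<noteq> c) (at z)" for c z :: complex
    by (cases "c = z") (auto intro: eventually_neq_at_within)
  have Qnz: "eventually (\<lambda>w. Q w \<noteq> 0) (at z)" for z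
  proof -
    have "eventually (\<lambda>w. \<forall>c\<in>Z. w \<noteq> c) (at z)"
      using finZ ne by (simp add: eventually_ball_finite_distrib)
    then show ?thesis by eventually_elim (auto simp: Q_def finZ)
  qed
  have Fnz: "eventually (\<lambda>w. F w \<noteq> 0) (at z)" for z
    using nonzero[of z] Qnz[of z] by eventually_elim (simp add: F_def)
  have Qord: "zorder Q z = - zorder f z" if "z \<in> ball 0 S" for z
  proof -
    have "zorder Q z = (\<Sum>c\<in>Z. zorder (\<lambda>w. (w - c) powi (- zorder f c)) z)"
      unfolding Q_def by (intro zorder_prod meromorphic_intros) (use Qnz in \<open>simp add: Q_def\<close>)
    also have "\<dots> = (\<Sum>c\<in>Z. if c = z then - zorder f z else 0)"
    proof (intro sum.cong refl)
      fix c assume "c \<in> Z"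
      have "zorder (\<lambda>w. (w - c) powi (- zorder f c)) z = - zorder f c * zorder (\<lambda>w. w - c) z"
        by (intro zorder_power_int meromorphic_intros)
           (use ne[of c z] in \<open>auto intro!: eventually_frequently elim: eventually_mono\<close>)
      also have "zorder (\<lambda>w. w - c) z = (if c = z then 1 else 0)"
      proof (cases "c = z")
        case True
        have "zorder (\<lambda>w. w - c) z = 1"
          by (rule zorder_eqI[of UNIV _ "\<lambda>_. 1"]) (use True in auto)
        then show ?thesis using True by simp
      next
        case False
        then show ?thesis by (simp, intro zorder_eq_0I) (auto intro!: analytic_intros)
      qed
      finally show "zorder (\<lambda>w. (w - c) powi (- zorder f c)) z = (if c = z then - zorder f z else 0)" by simp
    qed
    also have "\<dots> = - zorder f z" using zero_order[OF that] finZ by (simp add: sum.delta)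
    finally show ?thesis .
  qed
  have Ford: "zorder F z = 0" if "z \<in> ball 0 S" for z
    unfolding F_def using Qord[OF that] nonzero Qnz meroz Qmero
    by (subst zorder_mult) (auto intro: eventually_frequently)
  define G where "G = remove_sings F"
  have G: "G analytic_on {z}" "G z \<noteq> 0" if "z \<in> ball 0 S" for z
    unfolding G_def using zorder_eq_0_remove_sings[OF Fmero Fnz Ford[OF that]] by auto
  have "G holomorphic_on ball 0 S"
    using G(1) analytic_imp_holomorphic analytic_on_analytic_at by blast
  then obtain h where h: "h holomorphic_on ball 0 S" "\<And>z. z \<in> ball 0 S \<Longrightarrow> G z = exp (h z)"
    by (rule contractible_imp_holomorphic_log) (use G in \<open>auto intro: convex_imp_contractible\<close>)
  have fac: "f z = exp (h z) * (\<Prod>c\<in>Z. (z - c) powi zorder f c)" if "z \<in> ball 0 S" "z \<notin> Z" for z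
  proof -
    have "Q analytic_on {z}" unfolding Q_def
      using that(2) by (auto intro!: analytic_intros)
    then have "F analytic_on {z}" unfolding F_def by (intro analytic_intros notZ(1)[OF that])
    then have "F z = exp (h z)" using h(2)[OF that(1)] by (simp add: G_def)
    moreover have "Q z * (\<Prod>c\<in>Z. (z - c) powi zorder f c) = 1"
      unfolding Q_def prod.distrib[symmetric] using that(2)
      by (intro prod.neutral) (auto simp: power_int_minus field_simps)
    ultimately show ?thesis by (metis F_def mult.assoc mult.right_neutral)
  qed
  show ?thesis
  proof (rule that, unfold_locales)
    show "Z \<subseteq> ball 0 S" by (auto simp: Z_def)
  qed (use mero nonzero finZ h(1) fac zero_order in auto)
qed

section \<open>Counting function, proximity function and characteristic of a translate\<close>

lemma has_integral_counting_kernel: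
  fixes r x :: real
  assumes "1 \<le> r"
  shows "((\<lambda>t. (if x \<le> t then 1 else 0) / t) has_integral (ln (max r x) - ln (max 1 x))) {1..r}"
proof (cases "max 1 x \<le> r")
  case True
  have "((\<lambda>t. 1 / t) has_integral (ln r - ln (max 1 x))) {max 1 x..r}"
  proof (rule fundamental_theorem_of_calculus[OF True])
    fix t assume "t \<in> {max 1 x..r}"
    then have "t > 0" by auto
    then show "(ln has_vector_derivative 1 / t) (at t within {max 1 x..r})"
      by (auto intro!: derivative_eq_intros simp flip: has_real_derivative_iff_has_vector_derivative)
  qed
  then have "((\<lambda>t. if t \<in> {max 1 x..r} then 1 / t else 0) has_integral (ln r - ln (max 1 x))) {1..r}"
    by (subst has_integral_restrict) auto
  then have "((\<lambda>t. (if x \<le> t then 1 else 0) / t) has_integral (ln r - ln (max 1 x))) {1..r}"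
    by (rule has_integral_eq[rotated]) auto
  moreover have "max r x = r" using True by simp
  ultimately show ?thesis by simp
next
  case False
  then have "x > r" using assms by auto
  then have "((\<lambda>t. (if x \<le> t then 1 else 0) / t) has_integral 0) {1..r}"
    by (intro has_integral_is_0) auto
  then show ?thesis using \<open>x > r\<close> assms by simp
qed

lemma circ_int_ln_dist_shift: "r > 0 \<Longrightarrow> circ_int r (\<lambda>z. ln (norm (z + w - c)))"
  using circ_int_ln_dist[of r "c - w"] by (simp add: algebra_simps)

lemma circ_mean_ln_dist_shift: "r > 0 \<Longrightarrow> circ_mean r (\<lambda>z. ln (norm (z + w - c))) = ln (max r (norm (c - w)))"
  using circ_mean_ln_dist[of r "c - w"] by (simp add: algebra_simps)

text \<open>Passes from the gauge integral of \<open>nev_m\<close>, whose integrand is uncontrolled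
  where f is evaluated at a zero, a pole or a wrong value, to the mean of an explicit
  function.\<close>

lemma circle_spike:
  fixes u v :: "complex \<Rightarrow> real"
  assumes "r > 0" "finite F" "circ_int r v" "\<And>z. norm z = r \<Longrightarrow> z \<notin> F \<Longrightarrow> u z = v z"
  shows "1 / (2*pi) * integral {0..2*pi} (\<lambda>t. u (of_real r * cis t)) = circ_mean r v"
proof -
  have "integral {0..2*pi} (\<lambda>t. v (of_real r * cis t)) = integral {0..2*pi} (\<lambda>t. u (of_real r * cis t))"
    by (rule integral_spike[OF negligible_finite[OF finite_circle_preimage[OF assms(1,2)]]])
       (use assms in \<open>auto simp: norm_mult\<close>)
  then show ?thesis using circ_mean_integral[OF assms(3)] by simp
qed

context meromorphic_factorization
begin

definition pole_mult :: "complex \<Rightarrow> real" where "pole_mult c = real (nat (- zorder f c))"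
definition zero_mult :: "complex \<Rightarrow> real" where "zero_mult c = real (nat (zorder f c))"
text \<open>\<open>ln_den\<close> and \<open>ln_num\<close> are log |Q| and log |e^h P|. At a zero
  of Q or P the singular summand is 0 instead of minus infinity, which concerns only finitely many
  points of a circle.\<close>

definition ln_den :: "complex \<Rightarrow> real" where "ln_den w = (\<Sum>c\<in>Z. pole_mult c * ln (norm (w - c)))"
definition ln_num :: "complex \<Rightarrow> real" where "ln_num w = Re (h w) + (\<Sum>c\<in>Z. zero_mult c * ln (norm (w - c)))"

lemma mult_nonneg [simp]: "pole_mult c \<ge> 0" "zero_mult c \<ge> 0"
  by (simp_all add: pole_mult_def zero_mult_def)

lemma mult_add: "pole_mult c + zero_mult c = \<bar>real_of_int (zorder f c)\<bar>"
  and mult_diff: "zero_mult c - pole_mult c = real_of_int (zorder f c)"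
  by (auto simp: pole_mult_def zero_mult_def)

lemma is_pole_iff: "is_pole f c \<longleftrightarrow> zorder f c < 0"
  using mero nonzero by (intro is_pole_iff_zorder_neg) (auto intro: meromorphic_on_subset)

text \<open>The poles of the translate are the points c - w. The condition on t forces every pole
  with |c - w| \<le> t into the ball where \<open>Z\<close> contains all points of nonzero
  order.\<close>

lemma nev_n_shift:
  assumes "t + norm w < S"
  shows "real (nev_n t (\<lambda>z. f (z + w))) = (\<Sum>c\<in>Z. pole_mult c * (if norm (c - w) \<le> t then 1 else 0))"
proof -
  let ?P = "{c. is_pole f c \<and> norm (c - w) \<le> t}"
  have pole: "is_pole (\<lambda>z. f (z + w)) z \<longleftrightarrow> is_pole f (z + w)" for z
    using is_pole_shift_iff[of f w z] by (simp add: o_def add.commute)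
  have ord: "zorder (\<lambda>z. f (z + w)) z = zorder f (z + w)" for z
    using zorder_shift[of "\<lambda>z. f (z + w)" z] zorder_shift[of f "z + w"] by (simp add: add.assoc)
  have "nev_n t (\<lambda>z. f (z + w)) = (\<Sum>z | is_pole f (z + w) \<and> norm z \<le> t. nat (- zorder f (z + w)))"
    by (simp add: nev_n_def pole ord)
  also have "\<dots> = (\<Sum>c\<in>?P. nat (- zorder f c))"
    by (rule sum.reindex_bij_witness[of _ "\<lambda>c. c - w" "\<lambda>z. z + w"]) auto
  also have "?P = {c\<in>Z. is_pole f c \<and> norm (c - w) \<le> t}"
  proof -
    have "c \<in> Z" if "is_pole f c" "norm (c - w) \<le> t" for c
    proof (rule zorder_nonzero)
      have "norm c \<le> norm (c - w) + norm w" by (metis diff_add_cancel norm_triangle_ineq)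
      then show "c \<in> ball 0 S" using that assms by simp
    qed (use that is_pole_iff in auto)
    then show ?thesis by blast
  qed
  also have "real (\<Sum>c\<in>{c\<in>Z. is_pole f c \<and> norm (c - w) \<le> t}. nat (- zorder f c)) =
      (\<Sum>c\<in>Z. if is_pole f c \<and> norm (c - w) \<le> t then pole_mult c else 0)"
    unfolding of_nat_sum pole_mult_def sum.inter_filter[OF finite_Z] by (intro sum.cong) auto
  also have "\<dots> = (\<Sum>c\<in>Z. pole_mult c * (if norm (c - w) \<le> t then 1 else 0))"
    by (intro sum.cong) (auto simp: is_pole_iff pole_mult_def)
  finally show ?thesis .
qed

text \<open>A pole at distance x from the new centre is counted from t = x on; integrated against
  dt/t over [1, r] this gives log max(r, x) - log max(1, x), which is also right for x < 1 and for x
  > r.\<close>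

lemma nev_N_shift:
  assumes "1 \<le> r" "r + norm w < S"
  shows "nev_N r (\<lambda>z. f (z + w)) = (\<Sum>c\<in>Z. pole_mult c * (ln (max r (norm (c - w))) - ln (max 1 (norm (c - w)))))"
proof -
  have "((\<lambda>t. \<Sum>c\<in>Z. pole_mult c * ((if norm (c - w) \<le> t then 1 else 0) / t)) has_integral
        (\<Sum>c\<in>Z. pole_mult c * (ln (max r (norm (c - w))) - ln (max 1 (norm (c - w)))))) {1..r}"
    by (intro has_integral_sum[OF finite_Z] has_integral_mult_right has_integral_counting_kernel assms)
  then have "((\<lambda>t. real (nev_n t (\<lambda>z. f (z + w))) / t) has_integral
        (\<Sum>c\<in>Z. pole_mult c * (ln (max r (norm (c - w))) - ln (max 1 (norm (c - w)))))) {1..r}"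
    by (rule has_integral_eq[rotated]) (use assms nev_n_shift in \<open>auto simp: sum_divide_distrib\<close>)
  then show ?thesis by (simp add: nev_N_def integral_unique)
qed

lemma ln_norm_f:
  assumes "z \<in> ball 0 S" "z \<notin> Z"
  shows "f z \<noteq> 0" "ln (norm (f z)) = ln_num z - ln_den z"
proof -
  have nz: "z - c \<noteq> 0" if "c \<in> Z" for c using that assms by auto
  have "norm (f z) = exp (Re (h z)) * (\<Prod>c\<in>Z. norm (z - c) powi zorder f c)"
    using factorization[OF assms] by (simp add: norm_mult prod_norm[symmetric] norm_power_int)
  moreover have "(\<Prod>c\<in>Z. norm (z - c) powi zorder f c) > 0"
    using nz by (intro prod_pos zero_less_power_int) auto
  ultimately show "f z \<noteq> 0" by (metis exp_gt_zero mult_pos_pos norm_zero less_irrefl)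
  have "ln (norm (f z)) = Re (h z) + ln (\<Prod>c\<in>Z. norm (z - c) powi zorder f c)"
    using \<open>norm (f z) = _\<close> \<open>_ > 0\<close> by (simp add: ln_mult)
  also have "ln (\<Prod>c\<in>Z. norm (z - c) powi zorder f c) = (\<Sum>c\<in>Z. ln (norm (z - c) powi zorder f c))"
    using nz finite_Z by (intro ln_prod) (auto intro: zero_less_power_int)
  also have "\<dots> = (\<Sum>c\<in>Z. real_of_int (zorder f c) * ln (norm (z - c)))"
  proof (intro sum.cong refl)
    fix c assume "c \<in> Z"
    then have "norm (z - c) > 0" using nz by simp
    then show "ln (norm (z - c) powi zorder f c) = real_of_int (zorder f c) * ln (norm (z - c))"
      by (simp add: powr_real_of_int'[symmetric] ln_powr)
  qed
  also have "\<dots> = (\<Sum>c\<in>Z. zero_mult c * ln (norm (z - c))) - (\<Sum>c\<in>Z. pole_mult c * ln (norm (z - c)))"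
    by (simp add: mult_diff[symmetric] left_diff_distrib sum_subtractf)
  finally show "ln (norm (f z)) = ln_num z - ln_den z" by (simp add: ln_num_def ln_den_def)
qed

lemma circ_int_Re_h: "0 < r \<Longrightarrow> r + norm w < S \<Longrightarrow> circ_int r (\<lambda>z. Re (h (z + w)))"
  by (intro circ_int_continuous continuous_intros
       continuous_on_compose2[OF holomorphic_on_imp_continuous_on[OF holomorphic_h]])
     (auto intro: le_less_trans[OF norm_triangle_ineq])

lemma circ_int_den: "r > 0 \<Longrightarrow> circ_int r (\<lambda>z. ln_den (z + w))"
  unfolding ln_den_def by (intro circ_int_sum circ_int_cmult circ_int_ln_dist_shift)

lemma circ_int_num: "r > 0 \<Longrightarrow> r + norm w < S \<Longrightarrow> circ_int r (\<lambda>z. ln_num (z + w))"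
  unfolding ln_num_def by (intro circ_int_add circ_int_Re_h circ_int_sum circ_int_cmult circ_int_ln_dist_shift)

lemma circ_mean_den: "r > 0 \<Longrightarrow> circ_mean r (\<lambda>z. ln_den (z + w)) = (\<Sum>c\<in>Z. pole_mult c * ln (max r (norm (c - w))))"
  unfolding ln_den_def
  by (subst circ_mean_sum) (auto intro!: circ_int_cmult circ_int_ln_dist_shift simp: circ_mean_cmult circ_mean_ln_dist_shift)

lemma circ_mean_num: "r > 0 \<Longrightarrow> r < S \<Longrightarrow> circ_mean r ln_num = Re (h 0) + (\<Sum>c\<in>Z. zero_mult c * ln (max r (norm c)))"
  unfolding ln_num_def using circ_mean_Re_holomorphic[OF holomorphic_h, of r]
  by (subst circ_mean_add, auto intro!: circ_int_sum circ_int_cmult circ_int_ln_dist)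
     (subst circ_mean_sum, auto intro!: circ_int_cmult circ_int_ln_dist simp: circ_mean_cmult circ_mean_ln_dist)

text \<open>As max(0, u - v) = max(v, u) - v, the positive logarithm becomes a maximum minus
  \<open>ln_den\<close>, whose mean is known exactly.\<close>

lemma nev_m_shift:
  assumes "0 < r" "r + norm w < S"
  shows "nev_m r (\<lambda>z. f (z + w)) = circ_mean r (\<lambda>z. max (ln_den (z + w)) (ln_num (z + w)) - ln_den (z + w))"
  unfolding nev_m_def
proof (rule circle_spike[where u="\<lambda>z. log_plus (norm (f (z + w)))" and F="(\<lambda>c. c - w) ` Z"])
  fix z assume z: "norm z = r" "z \<notin> (\<lambda>c. c - w) ` Z"
  have "z + w \<in> ball 0 S" using z(1) assms norm_triangle_ineq[of z w] by simp
  moreover have "z + w \<notin> Z" using z(2) by (metis add_diff_cancel image_eqI)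
  ultimately have nz: "f (z + w) \<noteq> 0" and ln: "ln (norm (f (z + w))) = ln_num (z + w) - ln_den (z + w)"
    using ln_norm_f by auto
  have "log_plus (norm (f (z + w))) = max 0 (ln (norm (f (z + w))))"
    using nz by (auto simp: log_plus_def max_def)
  then show "log_plus (norm (f (z + w))) = max (ln_den (z + w)) (ln_num (z + w)) - ln_den (z + w)"
    unfolding ln by (auto simp: max_def)
qed (use assms finite_Z in \<open>auto intro!: circ_int_diff circ_int_max circ_int_den circ_int_num\<close>)

text \<open>The mean of \<open>ln_den\<close> is, pole by pole, the upper-limit term log max(r, |c -
  w|) of N. These cancel, and only the terms from the lower limit 1 survive.\<close>

lemma nev_T_shift:
  assumes "1 \<le> r" "r + norm w < S"
  shows "nev_T r (\<lambda>z. f (z + w)) =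
    circ_mean r (\<lambda>z. max (ln_den (z + w)) (ln_num (z + w))) - (\<Sum>c\<in>Z. pole_mult c * ln (max 1 (norm (c - w))))"
proof -
  have "nev_m r (\<lambda>z. f (z + w)) = circ_mean r (\<lambda>z. max (ln_den (z + w)) (ln_num (z + w))) - (\<Sum>c\<in>Z. pole_mult c * ln (max r (norm (c - w))))"
    using assms by (subst nev_m_shift, simp_all)
      (subst circ_mean_diff, auto intro!: circ_int_max circ_int_den circ_int_num simp: circ_mean_den)
  then show ?thesis using nev_N_shift[OF assms]
    by (simp add: nev_T_def right_diff_distrib sum_subtractf)
qed

end

section \<open>Jensen's formula and its consequences\<close>

definition jensen_const :: "(complex \<Rightarrow> complex) \<Rightarrow> real" where
  "jensen_const f = 1 / (2*pi) * integral {0..2*pi} (\<lambda>t. ln (norm (f (of_real 1 * cis t))))"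

context meromorphic_factorization
begin

lemma circ_mean_ln_f:
  assumes "0 < r" "r < S"
  shows "circ_mean r (\<lambda>z. ln_num z - ln_den z) = Re (h 0) + (\<Sum>c\<in>Z. (zero_mult c - pole_mult c) * ln (max r (norm c)))"
  using assms circ_int_den[of r 0] circ_int_num[of r 0] circ_mean_den[of r 0] circ_mean_num[of r]
  by (simp add: circ_mean_diff left_diff_distrib sum_subtractf)

text \<open>Subtracting the formula at radius 1 from that at radius R eliminates Re h(0). Thus
  \<open>jensen_const\<close> refers to f alone and not to the factorisation, which will change with
  r. The unit circle also matches the lower limit of N and allows a zero or pole at 0.\<close>

lemma jensen:
  assumes "1 \<le> R" "R < S"
  shows "circ_mean R (\<lambda>z. ln_num z - ln_den z) = jensen_const f +
     (\<Sum>c\<in>Z. (zero_mult c - pole_mult c) * (ln (max R (norm c)) - ln (max 1 (norm c))))"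
proof -
  have "jensen_const f = circ_mean 1 (\<lambda>z. ln_num z - ln_den z)"
    unfolding jensen_const_def
    by (rule circle_spike[where u="\<lambda>z. ln (norm (f z))" and F=Z])
       (use assms finite_Z ln_norm_f circ_int_den[of 1 0] circ_int_num[of 1 0] in \<open>auto intro!: circ_int_diff\<close>)
  then show ?thesis using assms circ_mean_ln_f[of R] circ_mean_ln_f[of 1]
    by (simp add: right_diff_distrib sum_subtractf)
qed

text \<open>Let A and B be the logarithmically weighted counts of zeros and poles, so that T = m + B
  and the mean of log |f| is J + A - B. From |x| = 2 max(x, 0) - x the absolute mean is 2m - (J + A
  - B) = 2T - J - A - B. As the mean is also at most m, A \<le> T - J, which together with B \<le> T
  bounds the count.\<close>

lemma
  assumes "1 \<le> R" "R < S"
  shows circ_mean_abs_ln_f: "circ_mean R (\<lambda>z. \<bar>ln_num z - ln_den z\<bar>) \<le> 2 * nev_T R f - jensen_const f"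
    and count_le: "(\<Sum>c\<in>Z. \<bar>real_of_int (zorder f c)\<bar> * (ln (max R (norm c)) - ln (max 1 (norm c)))) \<le> 2 * nev_T R f - jensen_const f"
proof -
  define L where "L = (\<lambda>c::complex. ln (max R (norm c)) - ln (max 1 (norm c)))"
  have L: "L c \<ge> 0" for c using assms by (auto simp: L_def)
  define A where "A = (\<Sum>c\<in>Z. zero_mult c * L c)"
  define B where "B = (\<Sum>c\<in>Z. pole_mult c * L c)"
  have AB: "A \<ge> 0" "B \<ge> 0" using L by (auto simp: A_def B_def intro!: sum_nonneg)
  define m where "m = circ_mean R (\<lambda>z. max (ln_den z) (ln_num z) - ln_den z)"
  have R: "R > 0" using assms by simp
  have T: "nev_T R f = m + B"
    using nev_m_shift[of R 0] nev_N_shift[of R 0] assms by (simp add: nev_T_def m_def B_def L_def)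
  have i: "circ_int R ln_den" "circ_int R ln_num" using circ_int_den[of R 0] circ_int_num[of R 0] assms by auto
  then have im: "circ_int R (\<lambda>z. max (ln_den z) (ln_num z) - ln_den z)" and iw: "circ_int R (\<lambda>z. ln_num z - ln_den z)"
    by (auto intro!: circ_int_diff circ_int_max)
  have J: "circ_mean R (\<lambda>z. ln_num z - ln_den z) = jensen_const f + A - B"
    using jensen[OF assms] by (simp add: A_def B_def L_def left_diff_distrib sum_subtractf)
  have "circ_mean R (\<lambda>z. 0) \<le> m" unfolding m_def
    by (rule circ_mean_mono[OF R, of "{}"]) (use im in auto)
  then have m0: "m \<ge> 0" by simp
  have "circ_mean R (\<lambda>z. ln_num z - ln_den z) \<le> m" unfolding m_def
    by (rule circ_mean_mono[OF R, of "{}"]) (use im iw in auto)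
  then have A_le: "A \<le> nev_T R f - jensen_const f" using J T by simp
  have "circ_mean R (\<lambda>z. \<bar>ln_num z - ln_den z\<bar>) = circ_mean R (\<lambda>z. 2 * (max (ln_den z) (ln_num z) - ln_den z) - (ln_num z - ln_den z))"
    by (rule circ_mean_cong_sphere[OF R]) (auto simp: max_def abs_if)
  also have "\<dots> = 2 * m - (jensen_const f + A - B)"
    using J by (simp only: circ_mean_diff[OF circ_int_cmult[OF im] iw] circ_mean_cmult m_def)
  finally show "circ_mean R (\<lambda>z. \<bar>ln_num z - ln_den z\<bar>) \<le> 2 * nev_T R f - jensen_const f"
    using T AB by simp
  have "(\<Sum>c\<in>Z. \<bar>real_of_int (zorder f c)\<bar> * L c) = B + A"
    by (simp add: A_def B_def mult_add[symmetric] distrib_right sum.distrib)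
  then show "(\<Sum>c\<in>Z. \<bar>real_of_int (zorder f c)\<bar> * (ln (max R (norm c)) - ln (max 1 (norm c)))) \<le> 2 * nev_T R f - jensen_const f"
    using A_le T m0 by (simp add: L_def)
qed

end

subsection \<open>The effect of a shift\<close>

text \<open>Up to t = 1 through log(1+t) \<le> t \<le> t^\<alpha>, beyond through log t =
  log(t^\<alpha>)/\<alpha>.\<close>

lemma ln_add_one_le_powr:
  fixes t \<alpha> :: real
  assumes "t \<ge> 0" "0 < \<alpha>" "\<alpha> \<le> 1"
  shows "ln (1 + t) \<le> t powr \<alpha> / \<alpha>"
proof (cases "t \<le> 1")
  case True
  have "ln (1 + t) \<le> t" using assms by (intro ln_add_one_self_le_self) auto
  also have "t \<le> t powr \<alpha>"
  proof (cases "t = 0")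
    case False
    then have "t powr 1 \<le> t powr \<alpha>" using assms True by (intro powr_mono') auto
    then show ?thesis using assms False by simp
  qed auto
  also have "\<dots> \<le> t powr \<alpha> / \<alpha>" using assms mult_left_mono[of \<alpha> 1 "t powr \<alpha>"] by (simp add: field_simps)
  finally show ?thesis .
next
  case False
  have "ln (1 + t) \<le> ln (2 * t)" using False by simp
  also have "\<dots> = ln 2 + ln t" using False by (simp add: ln_mult)
  also have "ln t = ln (t powr \<alpha>) / \<alpha>" using False assms by (simp add: ln_powr)
  also have "\<dots> \<le> (t powr \<alpha> - 1) / \<alpha>"
    using False assms by (intro divide_right_mono ln_le_minus_one) auto
  also have "ln 2 \<le> 1 / \<alpha>"
  proof -
    have "ln 2 \<le> (1::real)" using ln_le_minus_one[of "2::real"] by simp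
    also have "1 \<le> 1 / \<alpha>" using assms by simp
    finally show ?thesis .
  qed
  finally show ?thesis using assms by (simp add: diff_divide_distrib)
qed

lemma ln_diff_le:
  fixes x y d \<alpha> :: real
  assumes "x > 0" "y > 0" "\<bar>x - y\<bar> \<le> d" "0 < \<alpha>" "\<alpha> \<le> 1"
  shows "\<bar>ln x - ln y\<bar> \<le> d powr \<alpha> / \<alpha> * (x powr (-\<alpha>) + y powr (-\<alpha>))"
proof -
  have *: "ln u - ln v \<le> d powr \<alpha> / \<alpha> * v powr (-\<alpha>)" if "u > 0" "v > 0" "u - v \<le> d" "d \<ge> 0" for u v
  proof -
    have "ln u - ln v = ln (u / v)" using that by (simp add: ln_div)
    also have "\<dots> \<le> ln (1 + d / v)" using that by (intro ln_mono) (auto simp: field_simps)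
    also have "\<dots> \<le> (d / v) powr \<alpha> / \<alpha>" using that assms by (intro ln_add_one_le_powr) auto
    also have "\<dots> = d powr \<alpha> / \<alpha> * v powr (-\<alpha>)" using that by (simp add: powr_divide powr_minus_divide)
    finally show ?thesis .
  qed
  have "ln x - ln y \<le> d powr \<alpha> / \<alpha> * y powr (-\<alpha>)" "ln y - ln x \<le> d powr \<alpha> / \<alpha> * x powr (-\<alpha>)"
    using assms by (intro *; linarith)+
  moreover have "d powr \<alpha> / \<alpha> * y powr (-\<alpha>) \<ge> 0" "d powr \<alpha> / \<alpha> * x powr (-\<alpha>) \<ge> 0" using assms by auto
  ultimately show ?thesis by (simp add: distrib_left abs_le_iff)
qed

text \<open>\<open>ln_diff_le\<close> bounds the change by |w|^\<alpha> times the inverse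
  \<alpha>-th powers of the distances from z to c and to c - w. The means of these are bounded by
  \<open>circ_dist_powr\<close> with p = 1 - \<alpha>, uniformly in c and w.\<close>

lemma circ_mean_ln_shift:
  fixes \<alpha> :: real
  assumes "0 < \<alpha>" "\<alpha> < 1"
  obtains C where "C > 0" "\<And>r w c. r > 0 \<Longrightarrow>
    circ_mean r (\<lambda>z. \<bar>ln (norm (z + w - c)) - ln (norm (z - c))\<bar>) \<le> C * (norm w powr \<alpha> * r powr (-\<alpha>))"
proof -
  obtain D where D: "D > 0"
    "\<And>r a. r > 0 \<Longrightarrow> circ_int r (\<lambda>z. norm (z - a) powr ((1 - \<alpha>) - 1))"
    "\<And>r a. r > 0 \<Longrightarrow> circ_mean r (\<lambda>z. norm (z - a) powr ((1 - \<alpha>) - 1)) \<le> D * r powr ((1 - \<alpha>) - 1)"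
    using circ_dist_powr[of "1 - \<alpha>"] assms by auto
  have e: "(1 - \<alpha>) - 1 = -\<alpha>" by simp
  show ?thesis
  proof (rule that[of "2 * D / \<alpha>"])
    fix r :: real and w c :: complex assume r: "r > 0"
    let ?v = "\<lambda>z. norm w powr \<alpha> / \<alpha> * (norm (z - (c - w)) powr (-\<alpha>) + norm (z - c) powr (-\<alpha>))"
    have "circ_mean r (\<lambda>z. \<bar>ln (norm (z + w - c)) - ln (norm (z - c))\<bar>) \<le> circ_mean r ?v"
    proof (rule circ_mean_mono[OF r, of "{c, c - w}"])
      fix z assume "z \<notin> {c, c - w}"
      then have "norm (z - c) > 0" "norm (z + w - c) > 0" by auto
      moreover have "\<bar>norm (z + w - c) - norm (z - c)\<bar> \<le> norm w"
        using norm_triangle_ineq3[of "z + w - c" "z - c"] by simp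
      moreover have "z + w - c = z - (c - w)" by simp
      ultimately show "\<bar>ln (norm (z + w - c)) - ln (norm (z - c))\<bar> \<le> ?v z"
        using assms by (metis ln_diff_le less_imp_le)
    next
      show "circ_int r ?v" by (intro circ_int_cmult circ_int_add D(2)[unfolded e] r)
    qed (use r in \<open>auto intro!: circ_int_abs circ_int_diff circ_int_ln_dist circ_int_ln_dist_shift\<close>)
    also have "\<dots> = norm w powr \<alpha> / \<alpha> * (circ_mean r (\<lambda>z. norm (z - (c - w)) powr (-\<alpha>)) + circ_mean r (\<lambda>z. norm (z - c) powr (-\<alpha>)))"
      unfolding circ_mean_cmult using D(2)[unfolded e] r by (subst circ_mean_add) auto
    also have "\<dots> \<le> norm w powr \<alpha> / \<alpha> * (D * r powr (-\<alpha>) + D * r powr (-\<alpha>))"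
      using assms D(3)[unfolded e] r by (intro mult_left_mono add_mono) auto
    finally show "circ_mean r (\<lambda>z. \<bar>ln (norm (z + w - c)) - ln (norm (z - c))\<bar>) \<le> 2 * D / \<alpha> * (norm w powr \<alpha> * r powr (-\<alpha>))"
      by (simp add: mult_ac)
  qed (use D assms in auto)
qed

text \<open>Both rest on log u - log v \<le> log(1 + |w|/v), used in both directions. The first
  takes v \<ge> 1; for the second, |c| \<ge> 2|w| keeps both maxima at least half of max(1,
  |c|).\<close>

lemma ln_max_one_shift:
  fixes c w :: complex
  shows "\<bar>ln (max 1 (norm (c - w))) - ln (max 1 (norm c))\<bar> \<le> ln (1 + norm w)"
    and "2 * norm w \<le> norm c \<Longrightarrow> \<bar>ln (max 1 (norm (c - w))) - ln (max 1 (norm c))\<bar> \<le> 2 * norm w / max 1 (norm c)"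
proof -
  define X where "X = max 1 (norm (c - w))"
  define Y where "Y = max 1 (norm c)"
  have d: "\<bar>norm (c - w) - norm c\<bar> \<le> norm w" using norm_triangle_ineq3[of "c - w" c] by simp
  have XY: "X \<ge> 1" "Y \<ge> 1" "X \<le> Y + norm w" "Y \<le> X + norm w" using d by (auto simp: X_def Y_def)
  have *: "ln u - ln v \<le> ln (1 + norm w / v)" if "u \<ge> 1" "v \<ge> 1" "u \<le> v + norm w" for u v
  proof -
    have "ln u - ln v = ln (u / v)" using that by (simp add: ln_div)
    also have "\<dots> \<le> ln (1 + norm w / v)" using that by (intro ln_mono) (auto simp: field_simps)
    finally show ?thesis .
  qed
  have **: "ln (1 + norm w / v) \<le> ln (1 + norm w)" if "v \<ge> 1" for v
    using that by (intro ln_mono) (auto simp: divide_le_eq mult_le_cancel_left1 add_pos_nonneg)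
  show "\<bar>ln (max 1 (norm (c - w))) - ln (max 1 (norm c))\<bar> \<le> ln (1 + norm w)"
    using *[of X Y] *[of Y X] **[of X] **[of Y] XY unfolding X_def[symmetric] Y_def[symmetric] by (simp add: abs_le_iff)
  assume c: "2 * norm w \<le> norm c"
  have XY2: "X \<ge> Y / 2" using d c by (auto simp: X_def Y_def max_def)
  have ***: "ln u - ln v \<le> 2 * norm w / Y" if "u \<ge> 1" "v \<ge> 1" "u \<le> v + norm w" "v \<ge> Y / 2" for u v
  proof -
    have "ln u - ln v \<le> ln (1 + norm w / v)" by (rule *[OF that(1-3)])
    also have "\<dots> \<le> norm w / v" using that by (intro ln_add_one_self_le_self) auto
    also have "\<dots> \<le> norm w / (Y / 2)" using that XY by (intro divide_left_mono) auto
    finally show ?thesis by (simp add: mult.commute)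
  qed
  show "\<bar>ln (max 1 (norm (c - w))) - ln (max 1 (norm c))\<bar> \<le> 2 * norm w / max 1 (norm c)"
    using ***[of X Y] ***[of Y X] XY XY2 unfolding X_def[symmetric] Y_def[symmetric] by (simp add: abs_le_iff)
qed

section \<open>Shifting the exponential factor and the characteristic\<close>

context meromorphic_factorization
begin

text \<open>Re h is log |f| minus the sum of the terms log |z - c| weighted by orders. The absolute
  mean of log |f| comes from Jensen's formula; in the sum |z - c| \<le> 4r + 5r, the origin of the
  9.\<close>

lemma circ_mean_abs_Re_h:
  assumes r: "1 \<le> r" and S: "4 * r < S" "S \<le> 5 * r"
  shows "circ_mean (4 * r) (\<lambda>z. \<bar>Re (h z)\<bar>) \<le>
     2 * nev_T (4 * r) f - jensen_const f + 2 * ln (9 * r) * (\<Sum>c\<in>Z. \<bar>real_of_int (zorder f c)\<bar>)"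
proof -
  define R where "R = 4 * r"
  have R: "R > 0" "R \<ge> 1" "R < S" using r S by (auto simp: R_def)
  have i: "circ_int R ln_den" "circ_int R ln_num" "circ_int R (\<lambda>z. Re (h z))"
    using circ_int_den[of R 0] circ_int_num[of R 0] circ_int_Re_h[of R 0] R by auto
  let ?k = "\<lambda>c. \<bar>real_of_int (zorder f c)\<bar>"
  have "circ_mean R (\<lambda>z. \<bar>Re (h z)\<bar>) \<le>
     circ_mean R (\<lambda>z. \<bar>ln_num z - ln_den z\<bar> + (\<Sum>c\<in>Z. ?k c * (2 * ln (9 * r) - ln (norm (z - c)))))"
  proof (rule circ_mean_mono[OF R(1), of "{}"])
    fix z :: complex assume z: "norm z = R"
    have "Re (h z) = (ln_num z - ln_den z) - (\<Sum>c\<in>Z. (zero_mult c - pole_mult c) * ln (norm (z - c)))"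
      by (simp add: ln_num_def ln_den_def left_diff_distrib sum_subtractf)
    then have "\<bar>Re (h z)\<bar> \<le> \<bar>ln_num z - ln_den z\<bar> + \<bar>\<Sum>c\<in>Z. (zero_mult c - pole_mult c) * ln (norm (z - c))\<bar>"
      by (metis abs_triangle_ineq4)
    also have "\<bar>\<Sum>c\<in>Z. (zero_mult c - pole_mult c) * ln (norm (z - c))\<bar> \<le> (\<Sum>c\<in>Z. ?k c * (2 * ln (9 * r) - ln (norm (z - c))))"
    proof (rule order_trans[OF sum_abs], rule sum_mono)
      fix c assume "c \<in> Z"
      then have "norm c < 5 * r" using Z_subset S by auto
      then have "norm (z - c) \<le> 9 * r" using z norm_triangle_ineq4[of z c] by (simp add: R_def)
      moreover have "ln (9 * r) \<ge> 0" using r by (intro ln_ge_zero) auto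
      ultimately have "ln (norm (z - c)) \<le> ln (9 * r)"
        by (cases "z = c") (auto intro!: ln_mono)
      \<comment> \<open>If x \<le> L and L \<ge> 0, then |x| \<le> 2L - x; the right side is linear
        in the logarithm, so its mean is explicit.\<close>
      then have "\<bar>ln (norm (z - c))\<bar> \<le> 2 * ln (9 * r) - ln (norm (z - c))" using \<open>ln (9 * r) \<ge> 0\<close> by (simp add: abs_le_iff)
      then show "\<bar>(zero_mult c - pole_mult c) * ln (norm (z - c))\<bar> \<le> ?k c * (2 * ln (9 * r) - ln (norm (z - c)))"
        unfolding abs_mult mult_diff by (intro mult_left_mono) auto
    qed
    finally show "\<bar>Re (h z)\<bar> \<le> \<bar>ln_num z - ln_den z\<bar> + (\<Sum>c\<in>Z. ?k c * (2 * ln (9 * r) - ln (norm (z - c))))" by simp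
  qed (use i R in \<open>auto intro!: circ_int_abs circ_int_add circ_int_diff circ_int_sum circ_int_cmult circ_int_ln_dist\<close>)
  also have "\<dots> = circ_mean R (\<lambda>z. \<bar>ln_num z - ln_den z\<bar>) + (\<Sum>c\<in>Z. ?k c * (2 * ln (9 * r) - ln (max R (norm c))))"
  proof -
    have j: "circ_int R (\<lambda>z. 2 * ln (9 * r) - ln (norm (z - c)))" for c
      using R by (intro circ_int_diff circ_int_const circ_int_ln_dist)
    have "circ_mean R (\<lambda>z. 2 * ln (9 * r) - ln (norm (z - c))) = 2 * ln (9 * r) - ln (max R (norm c))" for c
      using R by (subst circ_mean_diff) (auto intro: circ_int_ln_dist simp: circ_mean_ln_dist)
    then show ?thesis using j i R
      by (subst circ_mean_add) (auto intro!: circ_int_ln_dist circ_int_abs circ_int_diff circ_int_sum circ_int_cmult simp: circ_mean_sum circ_int_cmult circ_mean_cmult)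
  qed
  also have "\<dots> \<le> (2 * nev_T R f - jensen_const f) + (\<Sum>c\<in>Z. ?k c * (2 * ln (9 * r)))"
    using R by (intro add_mono circ_mean_abs_ln_f sum_mono mult_left_mono) auto
  finally show ?thesis by (simp add: R_def sum_distrib_right mult.commute)
qed

text \<open>The segment from z to z + w stays in the disc of radius 2r, at distance at least 2r from
  the circle of radius 4r, so the derivative bound has the factor 8r/(2r)^2 = 2/r.\<close>

lemma norm_h_shift:
  assumes r: "1 \<le> r" and S: "4 * r < S" "S \<le> 5 * r" and w: "norm w \<le> r" and z: "norm z = r"
  shows "norm (h (z + w) - h z) \<le> 2 * norm w / r *
     (2 * nev_T (4 * r) f - jensen_const f + 2 * ln (9 * r) * (\<Sum>c\<in>Z. \<bar>real_of_int (zorder f c)\<bar>))"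
proof -
  define E where "E = 2 * nev_T (4 * r) f - jensen_const f + 2 * ln (9 * r) * (\<Sum>c\<in>Z. \<bar>real_of_int (zorder f c)\<bar>)"
  have mE: "circ_mean (4*r) (\<lambda>z. \<bar>Re (h z)\<bar>) \<le> E" unfolding E_def by (rule circ_mean_abs_Re_h[OF r S])
  have m0: "0 \<le> circ_mean (4*r) (\<lambda>z. \<bar>Re (h z)\<bar>)"
    using circ_mean_mono[of "4*r" "{}" "\<lambda>z. 0" "\<lambda>z. \<bar>Re (h z)\<bar>"] circ_int_abs[OF circ_int_Re_h[of "4*r" 0]] r S by auto
  have "norm (h (z + w) - h z) \<le> (2 / r * E) * norm ((z + w) - z)"
  proof (rule field_differentiable_bound[of "cball 0 (2 * r)"])
    fix y :: complex assume y: "y \<in> cball 0 (2 * r)"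
    then have "y \<in> ball 0 S" using r S by auto
    then show "(h has_field_derivative deriv h y) (at y within cball 0 (2 * r))"
      using holomorphic_h by (auto intro: holomorphic_derivI)
    have "norm (deriv h y) \<le> 2 * (4*r) / (4*r - norm y)^2 * circ_mean (4*r) (\<lambda>w. \<bar>Re (h w)\<bar>)"
      using y r S by (intro norm_deriv_le_circ_mean_Re[OF holomorphic_h]) auto
    also have "\<dots> \<le> 2 / r * E"
    proof (intro mult_mono mE m0)
      have "(2 * r)^2 \<le> (4*r - norm y)^2" using y r by (intro power_mono) auto
      then have "2 * (4*r) / (4*r - norm y)^2 \<le> 2 * (4*r) / (2 * r)^2" using r y by (intro divide_left_mono mult_pos_pos zero_less_power) auto
      also have "\<dots> = 2 / r" using r by (simp add: power2_eq_square)
      finally show "2 * (4*r) / (4*r - norm y)^2 \<le> 2 / r" .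
    qed (use r in auto)
    finally show "norm (deriv h y) \<le> 2 / r * E" .
  qed (use r w z in \<open>auto intro: order_trans[OF norm_triangle_ineq]\<close>)
  then show ?thesis unfolding E_def by (simp add: mult_ac)
qed

text \<open>The summands are, in order, the change of the factors z - c, the change of h, and the
  change of the lower-limit terms of N. Numerator and denominator share one sum because
  \<open>pole_mult\<close> and \<open>zero_mult\<close> add up to the absolute order.\<close>

lemma nev_T_shift_diff:
  assumes r: "1 \<le> r" and S: "4 * r < S" "S \<le> 5 * r" and w: "norm w \<le> r"
    and D: "\<And>c. circ_mean r (\<lambda>z. \<bar>ln (norm (z + w - c)) - ln (norm (z - c))\<bar>) \<le> D"
  shows "\<bar>nev_T r (\<lambda>z. f (z + w)) - nev_T r f\<bar> \<le> (\<Sum>c\<in>Z. \<bar>real_of_int (zorder f c)\<bar>) * D +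
     2 * norm w / r * (2 * nev_T (4 * r) f - jensen_const f + 2 * ln (9 * r) * (\<Sum>c\<in>Z. \<bar>real_of_int (zorder f c)\<bar>)) +
     (\<Sum>c\<in>Z. \<bar>real_of_int (zorder f c)\<bar> * \<bar>ln (max 1 (norm (c - w))) - ln (max 1 (norm c))\<bar>)"
proof -
  let ?k = "\<lambda>c. \<bar>real_of_int (zorder f c)\<bar>"
  let ?d = "\<lambda>c z. \<bar>ln (norm (z + w - c)) - ln (norm (z - c))\<bar>"
  define H where "H = 2 * norm w / r * (2 * nev_T (4 * r) f - jensen_const f + 2 * ln (9 * r) * (\<Sum>c\<in>Z. ?k c))"
  define m where "m = (\<lambda>z. max (ln_den z) (ln_num z))"
  have r0: "r > 0" and rS: "r + norm w < S" "r + norm (0::complex) < S" using r S w by auto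
  have i: "circ_int r (\<lambda>z. m (z + w))" "circ_int r m"
    using circ_int_den[OF r0] circ_int_num[OF r0] circ_int_den[OF r0, of 0] circ_int_num[OF r0, of 0] rS unfolding m_def
    by (auto intro!: circ_int_max)
  have di: "circ_int r (?d c)" for c using r0 by (intro circ_int_abs circ_int_diff circ_int_ln_dist circ_int_ln_dist_shift)
  have "\<bar>circ_mean r (\<lambda>z. m (z + w)) - circ_mean r m\<bar> = \<bar>circ_mean r (\<lambda>z. m (z + w) - m z)\<bar>"
    using i by (simp add: circ_mean_diff)
  also have "\<dots> \<le> circ_mean r (\<lambda>z. \<bar>m (z + w) - m z\<bar>)" using i by (intro circ_mean_abs circ_int_diff)
  also have "\<dots> \<le> circ_mean r (\<lambda>z. (\<Sum>c\<in>Z. ?k c * ?d c z) + H)"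
  proof (rule circ_mean_mono[OF r0, of "{}"])
    fix z :: complex assume z: "norm z = r"
    have den: "\<bar>ln_den (z + w) - ln_den z\<bar> \<le> (\<Sum>c\<in>Z. pole_mult c * ?d c z)"
      unfolding ln_den_def sum_subtractf[symmetric] right_diff_distrib[symmetric]
      by (rule order_trans[OF sum_abs]) (simp add: abs_mult)
    have "\<bar>ln_num (z + w) - ln_num z\<bar> \<le> \<bar>Re (h (z + w)) - Re (h z)\<bar> +
        \<bar>\<Sum>c\<in>Z. zero_mult c * (ln (norm (z + w - c)) - ln (norm (z - c)))\<bar>"
      unfolding ln_num_def sum_subtractf right_diff_distrib by linarith
    also have "\<bar>Re (h (z + w)) - Re (h z)\<bar> \<le> H"
      using norm_h_shift[OF r S w z] abs_Re_le_cmod[of "h (z + w) - h z"] by (simp add: H_def)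
    also have "\<bar>\<Sum>c\<in>Z. zero_mult c * (ln (norm (z + w - c)) - ln (norm (z - c)))\<bar> \<le> (\<Sum>c\<in>Z. zero_mult c * ?d c z)"
      by (rule order_trans[OF sum_abs]) (simp add: abs_mult)
    finally have num: "\<bar>ln_num (z + w) - ln_num z\<bar> \<le> H + (\<Sum>c\<in>Z. zero_mult c * ?d c z)" by simp
    have "\<bar>m (z + w) - m z\<bar> \<le> \<bar>ln_den (z + w) - ln_den z\<bar> + \<bar>ln_num (z + w) - ln_num z\<bar>"
      unfolding m_def by (auto simp: max_def abs_if)
    also have "\<dots> \<le> (\<Sum>c\<in>Z. pole_mult c * ?d c z) + (H + (\<Sum>c\<in>Z. zero_mult c * ?d c z))"
      by (rule add_mono[OF den num])
    also have "\<dots> = (\<Sum>c\<in>Z. ?k c * ?d c z) + H"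
      by (simp add: mult_add[symmetric] distrib_right sum.distrib)
    finally show "\<bar>m (z + w) - m z\<bar> \<le> (\<Sum>c\<in>Z. ?k c * ?d c z) + H" .
  qed (use i di r0 in \<open>auto intro!: circ_int_ln_dist circ_int_ln_dist_shift circ_int_abs circ_int_diff circ_int_add circ_int_sum circ_int_cmult\<close>)
  also have "\<dots> = (\<Sum>c\<in>Z. ?k c * circ_mean r (?d c)) + H"
    using di r0 by (subst circ_mean_add) (auto intro!: circ_int_ln_dist circ_int_ln_dist_shift circ_int_abs circ_int_diff circ_int_sum circ_int_cmult simp: circ_mean_sum circ_int_cmult circ_mean_cmult)
  also have "\<dots> \<le> (\<Sum>c\<in>Z. ?k c * D) + H" using D by (intro add_mono sum_mono mult_left_mono) auto
  finally have 1: "\<bar>circ_mean r (\<lambda>z. m (z + w)) - circ_mean r m\<bar> \<le> (\<Sum>c\<in>Z. ?k c) * D + H"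
    by (simp add: sum_distrib_right)
  have "\<bar>(\<Sum>c\<in>Z. pole_mult c * ln (max 1 (norm (c - w)))) - (\<Sum>c\<in>Z. pole_mult c * ln (max 1 (norm c)))\<bar> \<le>
      (\<Sum>c\<in>Z. ?k c * \<bar>ln (max 1 (norm (c - w))) - ln (max 1 (norm c))\<bar>)"
    unfolding sum_subtractf[symmetric] right_diff_distrib[symmetric]
  proof (rule order_trans[OF sum_abs], rule sum_mono)
    fix c
    have "pole_mult c \<le> ?k c" using mult_add[of c] mult_nonneg(2)[of c] by linarith
    then show "\<bar>pole_mult c * (ln (max 1 (norm (c - w))) - ln (max 1 (norm c)))\<bar> \<le> ?k c * \<bar>ln (max 1 (norm (c - w))) - ln (max 1 (norm c))\<bar>"
      unfolding abs_mult by (intro mult_right_mono) auto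
  qed
  moreover have "nev_T r (\<lambda>z. f (z + w)) = circ_mean r (\<lambda>z. m (z + w)) - (\<Sum>c\<in>Z. pole_mult c * ln (max 1 (norm (c - w))))"
    unfolding m_def by (rule nev_T_shift[OF r rS(1)])
  moreover have "nev_T r f = circ_mean r m - (\<Sum>c\<in>Z. pole_mult c * ln (max 1 (norm c)))"
    using nev_T_shift[OF r rS(2)] by (simp add: m_def)
  ultimately show ?thesis using 1 by (simp add: H_def)
qed

end

subsection \<open>Functions of finite order\<close>

lemma eventually_nev_T_le:
  assumes "nev_order f < ereal \<tau>"
  shows "eventually (\<lambda>r. nev_T r f \<le> r powr \<tau>) at_top"
proof -
  have "eventually (\<lambda>r. ereal (log_plus (nev_T r f) / ln r) < ereal \<tau>) at_top"
    using assms unfolding nev_order_def by (rule Limsup_lessD)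
  then show ?thesis using eventually_gt_at_top[of 1]
  proof eventually_elim
    case (elim r)
    then have "log_plus (nev_T r f) < \<tau> * ln r" by (simp add: field_simps)
    then have "exp (log_plus (nev_T r f)) \<le> exp (\<tau> * ln r)" by simp
    moreover have "exp (log_plus (nev_T r f)) = max 1 (nev_T r f)" by (simp add: log_plus_def)
    moreover have "exp (\<tau> * ln r) = r powr \<tau>" using elim by (simp add: powr_def)
    ultimately show ?case by linarith
  qed
qed

section \<open>Density of zeros and poles\<close>

context
  fixes f :: "complex \<Rightarrow> complex"
  assumes mero: "f meromorphic_on UNIV" and nonzero: "\<And>z. eventually (\<lambda>w. f w \<noteq> 0) (at z)"
begin

text \<open>Apply \<open>count_le\<close> at radius 3R: since 3 \<ge> e, every point of modulus at
  most R has weight at least log 3 \<ge> 1.\<close>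

lemma zorder_count_le:
  assumes R: "1 \<le> R" and A: "finite A" "A \<subseteq> cball 0 R"
  shows "(\<Sum>c\<in>A. \<bar>real_of_int (zorder f c)\<bar>) \<le> 2 * nev_T (3 * R) f - jensen_const f"
proof -
  obtain h Z where "meromorphic_factorization f h Z (3 * R + 1)"
    using meromorphic_factorization_exists[OF mero nonzero] .
  then interpret meromorphic_factorization f h Z "3 * R + 1" .
  let ?L = "\<lambda>c::complex. ln (max (3 * R) (norm c)) - ln (max 1 (norm c))"
  have L: "?L c \<ge> 0" for c using R by simp
  have L1: "?L c \<ge> 1" if "norm c \<le> R" for c
  proof -
    have "exp 1 \<le> (3::real)" using exp_le by simp
    then have "1 \<le> ln (3::real)" by (simp add: ln_ge_iff)
    moreover have "ln (max 1 (norm c)) \<le> ln R" using that R by (intro ln_mono) auto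
    moreover have "ln (max (3 * R) (norm c)) = ln 3 + ln R" using that R by (simp add: ln_mult max_def)
    ultimately show ?thesis by simp
  qed
  have "(\<Sum>c\<in>A. \<bar>real_of_int (zorder f c)\<bar>) = (\<Sum>c\<in>A \<inter> Z. \<bar>real_of_int (zorder f c)\<bar>)"
    by (rule sum.mono_neutral_right) (use A R zorder_nonzero in \<open>force+\<close>)
  also have "\<dots> \<le> (\<Sum>c\<in>A \<inter> Z. \<bar>real_of_int (zorder f c)\<bar> * ?L c)"
  proof (rule sum_mono)
    fix c assume "c \<in> A \<inter> Z"
    then have "norm c \<le> R" using A by auto
    from mult_left_mono[OF L1[OF this], of "\<bar>real_of_int (zorder f c)\<bar>"]
    show "\<bar>real_of_int (zorder f c)\<bar> \<le> \<bar>real_of_int (zorder f c)\<bar> * ?L c" by simp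
  qed
  also have "\<dots> \<le> (\<Sum>c\<in>Z. \<bar>real_of_int (zorder f c)\<bar> * ?L c)"
    using L finite_Z by (intro sum_mono2 mult_nonneg_nonneg) auto
  also have "\<dots> \<le> 2 * nev_T (3 * R) f - jensen_const f"
    by (rule count_le) (use R in auto)
  finally show ?thesis .
qed

text \<open>The growth bound for T holds only from some radius R0 on. Counting in the disc of radius
  R0 R instead of R makes it available for all R \<ge> 1, at the cost of the factor
  R0^\<tau>.\<close>

lemma zorder_count_growth:
  assumes "0 < \<tau>" "nev_order f < ereal \<tau>"
  obtains C where "C \<ge> 0" "\<And>R A. 1 \<le> R \<Longrightarrow> finite A \<Longrightarrow> A \<subseteq> cball 0 R \<Longrightarrow>
    (\<Sum>c\<in>A. \<bar>real_of_int (zorder f c)\<bar>) \<le> C * R powr \<tau>"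
proof -
  obtain R1 where R1: "\<And>r. r \<ge> R1 \<Longrightarrow> nev_T r f \<le> r powr \<tau>"
    using eventually_nev_T_le[OF assms(2)] by (auto simp: eventually_at_top_linorder)
  define R0 where "R0 = max 1 R1"
  define J where "J = \<bar>jensen_const f\<bar>"
  show ?thesis
  proof (rule that[of "(2 * 3 powr \<tau> + J) * R0 powr \<tau>"])
    show "(2 * 3 powr \<tau> + J) * R0 powr \<tau> \<ge> 0" by (simp add: J_def)
    fix R A assume R: "1 \<le> R" and A: "finite A" "A \<subseteq> cball (0::complex) R"
    define R' where "R' = R0 * R"
    have R': "R' \<ge> R0" "R' \<ge> R" "R0 \<ge> 1" "R' \<ge> 1"
    proof -
      show 1: "R0 \<ge> 1" by (simp add: R0_def)
      show 2: "R' \<ge> R0" using mult_left_mono[of 1 R R0] R 1 by (simp add: R'_def)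
      show "R' \<ge> R" using mult_right_mono[of 1 R0 R] R 1 by (simp add: R'_def)
      show "R' \<ge> 1" using 1 2 by simp
    qed
    have p1: "R' powr \<tau> \<ge> 1" using R' assms by (simp add: ge_one_powr_ge_zero)
    have "(\<Sum>c\<in>A. \<bar>real_of_int (zorder f c)\<bar>) \<le> 2 * nev_T (3 * R') f - jensen_const f"
      by (rule zorder_count_le) (use A R' in auto)
    also have "\<dots> \<le> 2 * (3 * R') powr \<tau> + J"
      using R1[of "3 * R'"] R' by (simp add: R0_def J_def)
    also have "\<dots> \<le> 2 * (3 powr \<tau> * R' powr \<tau>) + J * R' powr \<tau>"
      using p1 mult_left_mono[OF p1, of J] by (simp add: powr_mult J_def)
    also have "\<dots> = (2 * 3 powr \<tau> + J) * R0 powr \<tau> * R powr \<tau>"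
      by (simp add: R'_def powr_mult algebra_simps)
    finally show "(\<Sum>c\<in>A. \<bar>real_of_int (zorder f c)\<bar>) \<le> (2 * 3 powr \<tau> + J) * R0 powr \<tau> * R powr \<tau>" .
  qed
qed

text \<open>\<tau> exceeds the exponent of convergence of the zeros and poles. Some \<rho> < \<tau>
  still bounds the counts, and the gap makes the sum over dyadic discs geometric with ratio
  2^(\<rho>-\<tau>).\<close>

lemma zorder_weighted_sum_bounded:
  assumes "0 < \<tau>" "nev_order f < ereal \<tau>"
  obtains C where "C \<ge> 0" "\<And>A. finite A \<Longrightarrow>
    (\<Sum>c\<in>A. \<bar>real_of_int (zorder f c)\<bar> * max 1 (norm c) powr (- \<tau>)) \<le> C"
proof -
  obtain y where y: "nev_order f < ereal y" "y < \<tau>" using ereal_dense2[OF assms(2)] by auto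
  \<comment> \<open>The maximum with \<tau>/2 keeps \<rho> positive, as the count bound requires,
    whatever the sign of \<open>y\<close>.\<close>
  define \<rho> where "\<rho> = max y (\<tau> / 2)"
  have \<rho>: "0 < \<rho>" "\<rho> < \<tau>" using assms y by (auto simp: \<rho>_def)
  have "nev_order f < ereal \<rho>" using y by (simp add: \<rho>_def less_max_iff_disj)
  then obtain C where C: "C \<ge> 0" "\<And>R A. 1 \<le> R \<Longrightarrow> finite A \<Longrightarrow> A \<subseteq> cball 0 R \<Longrightarrow>
    (\<Sum>c\<in>A. \<bar>real_of_int (zorder f c)\<bar>) \<le> C * R powr \<rho>" using zorder_count_growth[OF \<rho>(1)] by blast
  let ?k = "\<lambda>c. \<bar>real_of_int (zorder f c)\<bar>"
  define q :: real where "q = 2 powr (\<rho> - \<tau>)"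
  have q: "0 < q" "q < 1" using \<rho> powr_less_one[of "2::real" "\<rho> - \<tau>"] by (auto simp: q_def)
  show ?thesis
  proof (rule that[of "2 powr \<tau> * (C / (1 - q))"])
    show "2 powr \<tau> * (C / (1 - q)) \<ge> 0" using C q by simp
    fix A :: "complex set" assume A: "finite A"
    \<comment> \<open>2^e(c) is the least dyadic radius that is at least max(1, |c|). It overshoots
      by a factor of at most 2, which accounts for the constant
      \<open>2 powr \<tau>\<close>.\<close>
    define e where "e = (\<lambda>c::complex. nat \<lceil>log 2 (max 1 (norm c))\<rceil>)"
    have e: "max 1 (norm c) \<le> 2 ^ e c" "2 ^ e c \<le> 2 * max 1 (norm c)" for c
    proof -
      define x where "x = max 1 (norm c)"
      have x: "x \<ge> 1" by (simp add: x_def)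
      then have l: "log 2 x \<ge> 0" by simp
      have b: "log 2 x \<le> real (e c)" "real (e c) \<le> log 2 x + 1"
        using l unfolding e_def x_def[symmetric] by linarith+
      have "x = 2 powr log 2 x" using x by simp
      also have "\<dots> \<le> 2 powr real (e c)" using b by simp
      finally show "max 1 (norm c) \<le> 2 ^ e c" by (simp add: powr_realpow x_def)
      have "2 powr real (e c) \<le> 2 powr (log 2 x + 1)" using b by simp
      also have "\<dots> = 2 * x" using x by (simp add: powr_add)
      finally show "2 ^ e c \<le> 2 * max 1 (norm c)" by (simp add: powr_realpow x_def)
    qed
    define K where "K = Suc (Max (insert 0 (e ` A)))"
    have eK: "e c < K" if "c \<in> A" for c using that A by (simp add: K_def less_Suc_eq_le)
    \<comment> \<open>The summand j = e(c) alone suffices. Summing over all discs that contain c,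
      rather than over annuli, lets the counts in discs enter once the sums are exchanged.\<close>
    have le: "max 1 (norm c) powr (- \<tau>) \<le> 2 powr \<tau> * (\<Sum>j<K. (2^j) powr (- \<tau>) * (if norm c \<le> 2^j then 1 else 0))"
      if "c \<in> A" for c
    proof -
      have "max 1 (norm c) powr (- \<tau>) = 2 powr \<tau> * (2 * max 1 (norm c)) powr (- \<tau>)"
        by (simp add: powr_mult powr_minus field_simps)
      also have "\<dots> \<le> 2 powr \<tau> * (2 ^ e c) powr (- \<tau>)"
        using e[of c] assms by (intro mult_left_mono powr_mono2') auto
      also have "(2 ^ e c) powr (- \<tau>) = (2 ^ e c) powr (- \<tau>) * (if norm c \<le> 2 ^ e c then 1 else 0)"
        using e(1)[of c] by simp
      also have "\<dots> \<le> (\<Sum>j<K. (2^j) powr (- \<tau>) * (if norm c \<le> 2^j then 1 else 0))"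
        by (rule member_le_sum) (use eK[OF that] in auto)
      finally show ?thesis by simp
    qed
    have "(\<Sum>c\<in>A. ?k c * max 1 (norm c) powr (- \<tau>)) \<le>
        (\<Sum>c\<in>A. ?k c * (2 powr \<tau> * (\<Sum>j<K. (2^j) powr (- \<tau>) * (if norm c \<le> 2^j then 1 else 0))))"
      by (intro sum_mono mult_left_mono le) auto
    also have "\<dots> = 2 powr \<tau> * (\<Sum>c\<in>A. \<Sum>j<K. (2^j) powr (- \<tau>) * (?k c * (if norm c \<le> 2^j then 1 else 0)))"
      by (simp only: sum_distrib_left mult_ac)
    also have "\<dots> = 2 powr \<tau> * (\<Sum>j<K. (2^j) powr (- \<tau>) * (\<Sum>c\<in>A. ?k c * (if norm c \<le> 2^j then 1 else 0)))"
      by (subst sum.swap) (simp only: sum_distrib_left)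
    also have "\<dots> \<le> 2 powr \<tau> * (\<Sum>j<K. C * q ^ j)"
    proof (intro mult_left_mono sum_mono)
      fix j
      have "(\<Sum>c\<in>A. ?k c * (if norm c \<le> 2^j then 1 else 0)) = (\<Sum>c\<in>A. if norm c \<le> 2^j then ?k c else 0)"
        by (intro sum.cong) auto
      also have "\<dots> = (\<Sum>c\<in>{c\<in>A. norm c \<le> 2^j}. ?k c)"
        using A by (simp only: sum.inter_filter)
      also have "\<dots> \<le> C * (2^j) powr \<rho>" by (rule C(2)) (use A in auto)
      finally have "(2^j) powr (- \<tau>) * (\<Sum>c\<in>A. ?k c * (if norm c \<le> 2^j then 1 else 0)) \<le> (2^j) powr (- \<tau>) * (C * (2^j) powr \<rho>)"
        by (rule mult_left_mono) simp
      also have "\<dots> = C * (2^j) powr (\<rho> - \<tau>)" by (simp add: powr_diff powr_minus field_simps)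
      also have "(2^j) powr (\<rho> - \<tau>) = q ^ j"
        unfolding q_def by (simp add: powr_powr powr_power flip: powr_realpow) (simp add: mult.commute)
      finally show "(2^j) powr (- \<tau>) * (\<Sum>c\<in>A. ?k c * (if norm c \<le> 2^j then 1 else 0)) \<le> C * q ^ j" .
    qed auto
    also have "(\<Sum>j<K. C * q ^ j) \<le> C / (1 - q)"
    proof -
      have "(\<Sum>j<K. q ^ j) \<le> (\<Sum>j. q ^ j)" using q by (intro sum_le_suminf) auto
      also have "\<dots> = 1 / (1 - q)" using q by (intro suminf_geometric) auto
      finally have "C * (\<Sum>j<K. q ^ j) \<le> C * (1 / (1 - q))" using C(1) by (rule mult_left_mono)
      then show ?thesis by (simp add: sum_distrib_left)
    qed
    finally show "(\<Sum>c\<in>A. ?k c * max 1 (norm c) powr (- \<tau>)) \<le> 2 powr \<tau> * (C / (1 - q))" by simp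
  qed
qed

text \<open>The near points number O(max(1,|w|)^\<tau>) with multiplicity. For the far ones write
  1/x = x^(\<tau>-1) x^(-\<tau>) with x = max(1,|c|): the second power is summable, and the first is
  at most R^max(\<tau>-1,0), where the maximum covers \<tau> < 1.\<close>

lemma ln_max_one_shift_sum:
  assumes "0 < \<tau>" "nev_order f < ereal \<tau>"
  obtains C where "C \<ge> 0" "\<And>A R w. finite A \<Longrightarrow> 1 \<le> R \<Longrightarrow> A \<subseteq> cball 0 R \<Longrightarrow>
    (\<Sum>c\<in>A. \<bar>real_of_int (zorder f c)\<bar> * \<bar>ln (max 1 (norm (c - w))) - ln (max 1 (norm c))\<bar>)
    \<le> C * (max 1 (norm w) powr \<tau> * ln (1 + norm w) + norm w * R powr max (\<tau> - 1) 0)"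
proof -
  let ?k = "\<lambda>c. \<bar>real_of_int (zorder f c)\<bar>"
  obtain C1 where C1: "C1 \<ge> 0" "\<And>R A. 1 \<le> R \<Longrightarrow> finite A \<Longrightarrow> A \<subseteq> cball 0 R \<Longrightarrow> (\<Sum>c\<in>A. ?k c) \<le> C1 * R powr \<tau>"
    using zorder_count_growth[OF assms] by blast
  obtain C2 where C2: "C2 \<ge> 0" "\<And>A. finite A \<Longrightarrow> (\<Sum>c\<in>A. ?k c * max 1 (norm c) powr (- \<tau>)) \<le> C2"
    using zorder_weighted_sum_bounded[OF assms] by blast
  show ?thesis
  proof (rule that[of "C1 * 2 powr \<tau> + 2 * C2"])
    show "C1 * 2 powr \<tau> + 2 * C2 \<ge> 0" using C1 C2 by simp
    fix A R and w :: complex assume A: "finite A" and R: "1 \<le> R" and AR: "A \<subseteq> cball (0::complex) R"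
    let ?d = "\<lambda>c. \<bar>ln (max 1 (norm (c - w))) - ln (max 1 (norm c))\<bar>"
    define A1 where "A1 = {c\<in>A. norm c < 2 * norm w}"
    define A2 where "A2 = {c\<in>A. \<not> norm c < 2 * norm w}"
    have fin: "finite A1" "finite A2" using A by (auto simp: A1_def A2_def)
    have split: "(\<Sum>c\<in>A. ?k c * ?d c) = (\<Sum>c\<in>A1. ?k c * ?d c) + (\<Sum>c\<in>A2. ?k c * ?d c)"
      using A by (subst sum.union_disjoint[symmetric]) (auto simp: A1_def A2_def intro!: sum.cong)
    have "(\<Sum>c\<in>A1. ?k c * ?d c) \<le> (\<Sum>c\<in>A1. ?k c * ln (1 + norm w))"
      by (intro sum_mono mult_left_mono ln_max_one_shift(1)) auto
    also have "\<dots> = (\<Sum>c\<in>A1. ?k c) * ln (1 + norm w)" by (simp add: sum_distrib_right)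
    also have "\<dots> \<le> (C1 * (2 * max 1 (norm w)) powr \<tau>) * ln (1 + norm w)"
      by (intro mult_right_mono C1(2) fin) (auto simp: A1_def)
    also have "\<dots> = C1 * 2 powr \<tau> * (max 1 (norm w) powr \<tau> * ln (1 + norm w))" by (simp add: powr_mult)
    finally have 1: "(\<Sum>c\<in>A1. ?k c * ?d c) \<le> C1 * 2 powr \<tau> * (max 1 (norm w) powr \<tau> * ln (1 + norm w))" .
    define M where "M = R powr max (\<tau> - 1) 0"
    have "(\<Sum>c\<in>A2. ?k c * ?d c) \<le> (\<Sum>c\<in>A2. (2 * norm w * M) * (?k c * max 1 (norm c) powr (- \<tau>)))"
    proof (rule sum_mono)
      fix c assume c: "c \<in> A2"
      define x where "x = max 1 (norm c)"
      have x: "x \<ge> 1" "x \<le> R" using c AR R by (auto simp: A2_def x_def)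
      have "1 / x = x powr (\<tau> - 1) * x powr (- \<tau>)" using x by (subst powr_add[symmetric]) (simp add: powr_minus_divide)
      also have "x powr (\<tau> - 1) \<le> M"
      proof -
        have "x powr (\<tau> - 1) \<le> x powr max (\<tau> - 1) 0" using x by (intro powr_mono) auto
        also have "\<dots> \<le> M" unfolding M_def using x by (intro powr_mono2) auto
        finally show ?thesis .
      qed
      finally have inv: "1 / x \<le> M * x powr (- \<tau>)" by (simp add: mult_right_mono)
      have "?d c \<le> 2 * norm w * (1 / x)"
        using ln_max_one_shift(2)[of w c] c by (simp add: A2_def x_def)
      also have "\<dots> \<le> 2 * norm w * (M * x powr (- \<tau>))" using inv by (intro mult_left_mono) auto
      finally have "?k c * ?d c \<le> ?k c * (2 * norm w * (M * x powr (- \<tau>)))" by (rule mult_left_mono) simp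
      then show "?k c * ?d c \<le> (2 * norm w * M) * (?k c * max 1 (norm c) powr (- \<tau>))" by (simp add: x_def mult_ac)
    qed
    also have "\<dots> = (2 * norm w * M) * (\<Sum>c\<in>A2. ?k c * max 1 (norm c) powr (- \<tau>))" by (simp add: sum_distrib_left)
    also have "\<dots> \<le> (2 * norm w * M) * C2" by (intro mult_left_mono C2(2) fin) (auto simp: M_def)
    finally have 2: "(\<Sum>c\<in>A2. ?k c * ?d c) \<le> 2 * C2 * (norm w * M)" by (simp add: mult_ac)
    have nn: "max 1 (norm w) powr \<tau> * ln (1 + norm w) \<ge> 0" "norm w * M \<ge> 0" by (auto simp: M_def)
    have "(\<Sum>c\<in>A. ?k c * ?d c) \<le> C1 * 2 powr \<tau> * (max 1 (norm w) powr \<tau> * ln (1 + norm w)) + 2 * C2 * (norm w * M)"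
      using split 1 2 by simp
    also have "\<dots> \<le> (C1 * 2 powr \<tau> + 2 * C2) * (max 1 (norm w) powr \<tau> * ln (1 + norm w)) + (C1 * 2 powr \<tau> + 2 * C2) * (norm w * M)"
      using nn C1(1) C2(1) by (intro add_mono mult_right_mono) auto
    finally show "(\<Sum>c\<in>A. ?k c * ?d c) \<le> (C1 * 2 powr \<tau> + 2 * C2) * (max 1 (norm w) powr \<tau> * ln (1 + norm w) + norm w * R powr max (\<tau> - 1) 0)"
      by (simp add: M_def distrib_left)
  qed
qed

end

text \<open>Each r gets its own factorisation, on the disc of radius 5r. It enters only through the
  count of zeros and poles, T(4r) and the sum over poles, all bounded with constants depending on f,
  \<tau> and \<alpha>. The quantifier over w stands inside \<open>eventually\<close>, which lets the
  step vary freely with r. The factor log r stems from the bound for h.\<close>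

lemma nev_T_shift_estimate:
  assumes mero: "f meromorphic_on UNIV" and nonzero: "\<And>z. eventually (\<lambda>w. f w \<noteq> 0) (at z)"
    and \<tau>: "0 < \<tau>" "nev_order f < ereal \<tau>" and \<alpha>: "0 < \<alpha>" "\<alpha> < 1"
  obtains C where "C \<ge> 0" "eventually (\<lambda>r. \<forall>w. norm w \<le> r \<longrightarrow>
    \<bar>nev_T r (\<lambda>z. f (z + w)) - nev_T r f\<bar> \<le> C * (r powr (\<tau> - \<alpha>) * ln r * norm w powr \<alpha> +
      max 1 (norm w) powr \<tau> * ln (1 + norm w) + norm w * r powr max (\<tau> - 1) 0)) at_top"
proof -
  let ?k = "\<lambda>c. \<bar>real_of_int (zorder f c)\<bar>"
  obtain C1 where C1: "C1 \<ge> 0" "\<And>R A. 1 \<le> R \<Longrightarrow> finite A \<Longrightarrow> A \<subseteq> cball 0 R \<Longrightarrow> (\<Sum>c\<in>A. ?k c) \<le> C1 * R powr \<tau>"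
    using zorder_count_growth[OF mero nonzero \<tau>] by blast
  obtain C2 where C2: "C2 \<ge> 0" "\<And>A R w. finite A \<Longrightarrow> 1 \<le> R \<Longrightarrow> A \<subseteq> cball 0 R \<Longrightarrow>
    (\<Sum>c\<in>A. ?k c * \<bar>ln (max 1 (norm (c - w))) - ln (max 1 (norm c))\<bar>)
    \<le> C2 * (max 1 (norm w) powr \<tau> * ln (1 + norm w) + norm w * R powr max (\<tau> - 1) 0)"
    using ln_max_one_shift_sum[OF mero nonzero \<tau>] by blast
  obtain C3 where C3: "C3 > 0" "\<And>r w c. r > 0 \<Longrightarrow>
    circ_mean r (\<lambda>z. \<bar>ln (norm (z + w - c)) - ln (norm (z - c))\<bar>) \<le> C3 * (norm w powr \<alpha> * r powr (-\<alpha>))"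
    using circ_mean_ln_shift[OF \<alpha>] by blast
  obtain R1 where R1: "\<And>r. r \<ge> R1 \<Longrightarrow> nev_T r f \<le> r powr \<tau>"
    using eventually_nev_T_le[OF \<tau>(2)] by (auto simp: eventually_at_top_linorder)
  define J where "J = \<bar>jensen_const f\<bar>"
  define M1 where "M1 = C1 * 5 powr \<tau>"
  \<comment> \<open>Coefficient of r^\<tau> log r in the bound for h: the three summands come from 2
    T(4r), from Jensen's constant, and from 2 log(9r) \<le> 4 log r times the count.\<close>
  define Q where "Q = 2 * 4 powr \<tau> + J + 4 * M1"
  define m where "m = max (\<tau> - 1) 0"
  define C where "C = M1 * C3 + 2 * Q + C2 * 5 powr m"
  have pos: "J \<ge> 0" "M1 \<ge> 0" "Q \<ge> 0" using C1 by (auto simp: J_def M1_def Q_def)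
  show ?thesis
  proof (rule that[of C])
    show "C \<ge> 0" using pos C2(1) C3(1) by (simp add: C_def)
    \<comment> \<open>From 9 on, log(9r) \<le> 2 log r and log r \<ge> 1.\<close>
    have "eventually (\<lambda>r. r \<ge> max 9 R1) at_top" by (rule eventually_ge_at_top)
    then show "eventually (\<lambda>r. \<forall>w. norm w \<le> r \<longrightarrow>
      \<bar>nev_T r (\<lambda>z. f (z + w)) - nev_T r f\<bar> \<le> C * (r powr (\<tau> - \<alpha>) * ln r * norm w powr \<alpha> +
        max 1 (norm w) powr \<tau> * ln (1 + norm w) + norm w * r powr max (\<tau> - 1) 0)) at_top"
    proof (eventually_elim, intro allI impI)
      fix r and w :: complex assume "r \<ge> max 9 R1" and w: "norm w \<le> r"
      then have r: "r \<ge> 9" "r \<ge> R1" by auto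
      obtain h Z where "meromorphic_factorization f h Z (5 * r)"
        using meromorphic_factorization_exists[OF mero nonzero] .
      then interpret meromorphic_factorization f h Z "5 * r" .
      define N where "N = (\<Sum>c\<in>Z. ?k c)"
      define x where "x = norm w powr \<alpha> * r powr (-\<alpha>)"
      have x: "x \<ge> 0" by (simp add: x_def)
      have Z5: "Z \<subseteq> cball 0 (5 * r)" using Z_subset by auto
      have N: "N \<le> M1 * r powr \<tau>"
        using C1(2)[OF _ finite_Z Z5] r by (simp add: N_def M1_def powr_mult mult.assoc)
      have N0: "N \<ge> 0" by (simp add: N_def sum_nonneg)
      have "exp 1 \<le> r" using exp_le r by simp
      then have lr: "ln r \<ge> 1" using r by (subst ln_ge_iff) auto
      have rt: "r powr \<tau> \<ge> 1" using r \<tau> by (simp add: ge_one_powr_ge_zero)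
      have rl: "r powr \<tau> * ln r \<ge> 1" using mult_mono[OF rt lr] by simp
      have rtl: "r powr \<tau> \<le> r powr \<tau> * ln r" using mult_left_mono[OF lr, of "r powr \<tau>"] by simp
      have l9: "ln (9 * r) \<le> 2 * ln r" using r by (simp add: ln_mult)
      \<comment> \<open>Since |w|/r \<le> 1, the linear factor from h is absorbed into the same
        power \<alpha> that comes from the factors z - c.\<close>
      have wx: "norm w / r \<le> x"
      proof -
        have "norm w / r = (norm w / r) powr 1" using r by simp
        also have "\<dots> \<le> (norm w / r) powr \<alpha>" using w r \<alpha> by (intro powr_mono') auto
        also have "\<dots> = x" using r by (simp add: x_def powr_divide powr_minus_divide)
        finally show ?thesis .
      qed
      have "\<bar>nev_T r (\<lambda>z. f (z + w)) - nev_T r f\<bar> \<le> N * (C3 * x) +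
         2 * norm w / r * (2 * nev_T (4 * r) f - jensen_const f + 2 * ln (9 * r) * N) +
         (\<Sum>c\<in>Z. ?k c * \<bar>ln (max 1 (norm (c - w))) - ln (max 1 (norm c))\<bar>)"
        unfolding N_def x_def by (rule nev_T_shift_diff) (use r w C3(2) in auto)
      also have "N * (C3 * x) \<le> M1 * (r powr \<tau> * ln r) * (C3 * x)"
        using order_trans[OF N mult_left_mono[OF rtl pos(2)]] C3(1) x by (intro mult_right_mono) auto
      also have "2 * norm w / r * (2 * nev_T (4 * r) f - jensen_const f + 2 * ln (9 * r) * N) \<le> 2 * x * (Q * (r powr \<tau> * ln r))"
      proof -
        have "2 * nev_T (4 * r) f \<le> 2 * (4 powr \<tau> * (r powr \<tau> * ln r))"
        proof -
          have "nev_T (4 * r) f \<le> 4 powr \<tau> * r powr \<tau>" using R1[of "4 * r"] r by (simp add: powr_mult)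
          also have "\<dots> \<le> 4 powr \<tau> * (r powr \<tau> * ln r)" by (intro mult_left_mono rtl) auto
          finally show ?thesis by simp
        qed
        moreover have "- jensen_const f \<le> J * (r powr \<tau> * ln r)"
          using mult_left_mono[OF rl pos(1)] by (simp add: J_def)
        moreover have "2 * ln (9 * r) * N \<le> 4 * M1 * (r powr \<tau> * ln r)"
        proof -
          have "2 * ln (9 * r) * N \<le> (4 * ln r) * N" using l9 N0 by (intro mult_right_mono) auto
          also have "\<dots> \<le> (4 * ln r) * (M1 * r powr \<tau>)" using lr N by (intro mult_left_mono) auto
          finally have "2 * ln (9 * r) * N \<le> (4 * ln r) * (M1 * r powr \<tau>)" .
          then show ?thesis by (simp add: mult_ac)
        qed
        ultimately have "2 * nev_T (4 * r) f - jensen_const f + 2 * ln (9 * r) * N \<le> Q * (r powr \<tau> * ln r)"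
        proof -
          have "Q * (r powr \<tau> * ln r) = 2 * (4 powr \<tau> * (r powr \<tau> * ln r)) + J * (r powr \<tau> * ln r) + 4 * M1 * (r powr \<tau> * ln r)"
            by (simp add: Q_def algebra_simps)
          with \<open>2 * nev_T (4 * r) f \<le> _\<close> \<open>- jensen_const f \<le> _\<close> \<open>2 * ln (9 * r) * N \<le> _\<close> show ?thesis by linarith
        qed
        then have "norm w / r * (2 * nev_T (4 * r) f - jensen_const f + 2 * ln (9 * r) * N) \<le> norm w / r * (Q * (r powr \<tau> * ln r))"
          by (rule mult_left_mono) (use r in auto)
        also have "\<dots> \<le> x * (Q * (r powr \<tau> * ln r))"
          using wx pos lr by (intro mult_right_mono mult_nonneg_nonneg) auto
        finally show ?thesis by (simp add: mult.assoc)
      qed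
      also have "(\<Sum>c\<in>Z. ?k c * \<bar>ln (max 1 (norm (c - w))) - ln (max 1 (norm c))\<bar>) \<le>
          C2 * (max 1 (norm w) powr \<tau> * ln (1 + norm w) + norm w * (5 * r) powr m)"
        unfolding m_def by (rule C2(2)[OF finite_Z _ Z5]) (use r in auto)
      finally have "\<bar>nev_T r (\<lambda>z. f (z + w)) - nev_T r f\<bar> \<le> (M1 * C3 + 2 * Q) * (r powr \<tau> * ln r * x) +
          C2 * (max 1 (norm w) powr \<tau> * ln (1 + norm w) + norm w * (5 * r) powr m)"
        by (simp add: algebra_simps)
      also have "\<dots> \<le> C * (r powr \<tau> * ln r * x) + C * (max 1 (norm w) powr \<tau> * ln (1 + norm w) + norm w * r powr m)"
      proof (rule add_mono)
        have "r powr \<tau> * ln r * x \<ge> 0" using lr x by simp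
        then show "(M1 * C3 + 2 * Q) * (r powr \<tau> * ln r * x) \<le> C * (r powr \<tau> * ln r * x)"
          using C2(1) by (intro mult_right_mono) (auto simp: C_def)
        define u where "u = max 1 (norm w) powr \<tau> * ln (1 + norm w)"
        have u: "u \<ge> 0" by (simp add: u_def)
        have five: "1 \<le> (5::real) powr m" by (simp add: m_def ge_one_powr_ge_zero)
        have "C2 * (u + norm w * (5 * r) powr m) \<le> C2 * (5 powr m * u + 5 powr m * (norm w * r powr m))"
          using C2(1) u mult_right_mono[OF five u] by (intro mult_left_mono add_mono) (auto simp: powr_mult)
        also have "\<dots> = C2 * 5 powr m * (u + norm w * r powr m)" by (simp add: algebra_simps)
        also have "\<dots> \<le> C * (u + norm w * r powr m)"
          using pos C3(1) u by (intro mult_right_mono add_nonneg_nonneg) (auto simp: C_def)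
        finally show "C2 * (max 1 (norm w) powr \<tau> * ln (1 + norm w) + norm w * (5 * r) powr m) \<le>
            C * (max 1 (norm w) powr \<tau> * ln (1 + norm w) + norm w * r powr m)" by (simp add: u_def)
      qed
      also have "r powr \<tau> * ln r * x = r powr (\<tau> - \<alpha>) * ln r * norm w powr \<alpha>"
        by (simp add: x_def powr_diff powr_minus field_simps)
      finally show "\<bar>nev_T r (\<lambda>z. f (z + w)) - nev_T r f\<bar> \<le> C * (r powr (\<tau> - \<alpha>) * ln r * norm w powr \<alpha> +
          max 1 (norm w) powr \<tau> * ln (1 + norm w) + norm w * r powr max (\<tau> - 1) 0)"
        by (simp add: m_def distrib_left)
    qed
  qed
qed

text \<open>The degenerate case, outside the scope of the factorisation. Such an f has limit 0
  everywhere, hence no poles, and its stray nonzero values meet a circle in finitely many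
  points.\<close>

lemma nev_T_shift_eq_0:
  assumes f: "eventually (\<lambda>z. f z = 0) (cosparse UNIV)" and "0 < r"
  shows "nev_T r (\<lambda>z. f (z + w)) = 0"
proof -
  have ev: "eventually (\<lambda>z. f z = 0) (at z)" for z using f by (simp add: eventually_cosparse_open_eq)
  have "\<not> is_pole (\<lambda>z. f (z + w)) z" for z
  proof
    assume "is_pole (\<lambda>z. f (z + w)) z"
    then have "is_pole f (z + w)" using is_pole_shift_iff[of f w z] by (simp add: o_def add.commute)
    then have "filterlim f at_infinity (at (z + w))" by (simp add: is_pole_def)
    moreover have "(f \<longlongrightarrow> 0) (at (z + w))" using ev by (rule tendsto_eventually)
    ultimately show False using not_tendsto_and_filterlim_at_infinity[of "at (z + w)"] by auto
  qed
  then have "nev_N r (\<lambda>z. f (z + w)) = 0" by (simp add: nev_N_def nev_n_def)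
  have "{z. f z \<noteq> 0} sparse_in UNIV" using f by (simp add: eventually_cosparse)
  then have "finite (cball w r \<inter> {z. f z \<noteq> 0})"
    by (intro sparse_in_compact_finite) (auto intro: sparse_in_subset)
  then have fin: "finite ((\<lambda>z. z - w) ` (cball w r \<inter> {z. f z \<noteq> 0}))" by simp
  have "nev_m r (\<lambda>z. f (z + w)) = circ_mean r (\<lambda>z. 0)"
    unfolding nev_m_def
  proof (rule circle_spike[OF assms(2) fin, where u="\<lambda>z. log_plus (norm (f (z + w)))"])
    fix z assume z: "norm z = r" "z \<notin> (\<lambda>z. z - w) ` (cball w r \<inter> {z. f z \<noteq> 0})"
    have "f (z + w) = 0"
    proof (rule ccontr)
      assume "f (z + w) \<noteq> 0"
      then have "z + w \<in> cball w r \<inter> {z. f z \<noteq> 0}" using z(1) by (simp add: dist_norm)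
      then show False using z(2) by (metis add_diff_cancel image_eqI)
    qed
    then show "log_plus (norm (f (z + w))) = 0" by (simp add: log_plus_def)
  qed auto
  then show ?thesis using \<open>nev_N r _ = 0\<close> by (simp add: nev_T_def)
qed

section \<open>The three ranges of the order\<close>

lemma eq_bigo_outsideI:
  assumes "eventually (\<lambda>r. \<bar>g r - h r\<bar> \<le> C * e r) at_top"
  shows "eq_bigo_outside g h e"
proof -
  have "(\<lambda>r. g r - h r) \<in> O(e)"
  proof (rule bigoI[of _ "\<bar>C\<bar>"])
    show "eventually (\<lambda>r. norm (g r - h r) \<le> \<bar>C\<bar> * norm (e r)) at_top"
      using assms by eventually_elim (metis abs_ge_self abs_mult order_trans real_norm_def)
  qed
  moreover have "finite_log_measure {}" by (simp add: finite_log_measure_def)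
  ultimately show ?thesis by (auto simp: eq_bigo_outside_def)
qed

text \<open>The three conditions on \<gamma> match the three terms of
  \<open>nev_T_shift_estimate\<close> after inserting |\<omega>| < r^\<beta>. Each logarithm is
  traded for a \<delta>-th power, of r in the first term and of r^\<beta> in the second.\<close>

lemma eq_bigo_outside_powr:
  assumes "f meromorphic_on UNIV" "\<And>z. eventually (\<lambda>w. f w \<noteq> 0) (at z)"
    and \<tau>: "0 < \<tau>" "nev_order f < ereal \<tau>" and \<alpha>: "0 < \<alpha>" "\<alpha> < 1" and \<beta>: "0 < \<beta>" "\<beta> < 1" and \<delta>: "0 < \<delta>" "\<delta> \<le> 1"
    and \<omega>: "\<And>r. r > 0 \<Longrightarrow> norm (\<omega> r) < r powr \<beta>"
    and \<gamma>: "\<tau> - \<alpha> + \<delta> + \<alpha> * \<beta> \<le> \<gamma>" "\<beta> * \<tau> + \<beta> * \<delta> \<le> \<gamma>" "\<beta> + max (\<tau> - 1) 0 \<le> \<gamma>"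
  shows "eq_bigo_outside (\<lambda>r. nev_T r (\<lambda>z. f (z + \<omega> r))) (\<lambda>r. nev_T r f) (\<lambda>r. r powr \<gamma>)"
proof -
  obtain C where C: "C \<ge> 0" "eventually (\<lambda>r. \<forall>w. norm w \<le> r \<longrightarrow>
    \<bar>nev_T r (\<lambda>z. f (z + w)) - nev_T r f\<bar> \<le> C * (r powr (\<tau> - \<alpha>) * ln r * norm w powr \<alpha> +
      max 1 (norm w) powr \<tau> * ln (1 + norm w) + norm w * r powr max (\<tau> - 1) 0)) at_top"
    using nev_T_shift_estimate[OF assms(1,2) \<tau> \<alpha>] by blast
  show ?thesis
  proof (rule eq_bigo_outsideI[where C = "C * (2 / \<delta> + 1)"])
    show "eventually (\<lambda>r. \<bar>nev_T r (\<lambda>z. f (z + \<omega> r)) - nev_T r f\<bar> \<le> C * (2 / \<delta> + 1) * r powr \<gamma>) at_top"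
      using C(2) eventually_ge_at_top[of 1]
    proof eventually_elim
      case (elim r)
      define s where "s = r powr \<beta>"
      have r: "r \<ge> 1" using elim by simp
      have w: "norm (\<omega> r) \<le> s" using \<omega>[of r] r by (simp add: s_def)
      have s: "1 \<le> s" "s \<le> r" using r \<beta> powr_mono[of \<beta> 1 r] by (auto simp: s_def ge_one_powr_ge_zero)
      have p: "r powr a \<le> r powr \<gamma>" if "a \<le> \<gamma>" for a using that r by (intro powr_mono) auto
      have "\<bar>nev_T r (\<lambda>z. f (z + \<omega> r)) - nev_T r f\<bar> \<le> C * (r powr (\<tau> - \<alpha>) * ln r * norm (\<omega> r) powr \<alpha> +
          max 1 (norm (\<omega> r)) powr \<tau> * ln (1 + norm (\<omega> r)) + norm (\<omega> r) * r powr max (\<tau> - 1) 0)"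
        using elim(1) w s by auto
      also have "\<dots> \<le> C * (r powr \<gamma> / \<delta> + r powr \<gamma> / \<delta> + r powr \<gamma>)"
      proof (intro mult_left_mono add_mono C(1))
        have "r powr (\<tau> - \<alpha>) * ln r * norm (\<omega> r) powr \<alpha> \<le> r powr (\<tau> - \<alpha>) * (r powr \<delta> / \<delta>) * s powr \<alpha>"
          using r w \<alpha> \<delta> ln_powr_bound[of r \<delta>] by (intro mult_mono[OF mult_left_mono powr_mono2]) auto
        also have "\<dots> = r powr (\<tau> - \<alpha> + \<delta> + \<alpha> * \<beta>) / \<delta>"
          by (simp add: s_def powr_powr powr_add mult.commute)
        also have "\<dots> \<le> r powr \<gamma> / \<delta>" using p \<gamma> \<delta> by (intro divide_right_mono) auto
        finally show "r powr (\<tau> - \<alpha>) * ln r * norm (\<omega> r) powr \<alpha> \<le> r powr \<gamma> / \<delta>" .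
        have "max 1 (norm (\<omega> r)) powr \<tau> * ln (1 + norm (\<omega> r)) \<le> s powr \<tau> * (s powr \<delta> / \<delta>)"
        proof (intro mult_mono powr_mono2)
          have "ln (1 + norm (\<omega> r)) \<le> ln (1 + s)" using w by (intro ln_mono) (auto intro: add_pos_nonneg)
          also have "\<dots> \<le> s powr \<delta> / \<delta>" using s \<delta> by (intro ln_add_one_le_powr) auto
          finally show "ln (1 + norm (\<omega> r)) \<le> s powr \<delta> / \<delta>" .
        qed (use w s \<tau> in auto)
        also have "\<dots> = r powr (\<beta> * \<tau> + \<beta> * \<delta>) / \<delta>" by (simp add: s_def powr_powr powr_add)
        also have "\<dots> \<le> r powr \<gamma> / \<delta>" using p \<gamma> \<delta> by (intro divide_right_mono) auto
        finally show "max 1 (norm (\<omega> r)) powr \<tau> * ln (1 + norm (\<omega> r)) \<le> r powr \<gamma> / \<delta>" .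
        have "norm (\<omega> r) * r powr max (\<tau> - 1) 0 \<le> s * r powr max (\<tau> - 1) 0" using w by (intro mult_right_mono) auto
        also have "\<dots> = r powr (\<beta> + max (\<tau> - 1) 0)" by (simp add: s_def powr_add)
        also have "\<dots> \<le> r powr \<gamma>" using p \<gamma> by simp
        finally show "norm (\<omega> r) * r powr max (\<tau> - 1) 0 \<le> r powr \<gamma>" .
      qed
      also have "\<dots> = C * (2 / \<delta> + 1) * r powr \<gamma>" by (simp add: algebra_simps)
      finally show ?case .
    qed
  qed
qed

lemma eq_bigo_outside_ln:
  assumes "f meromorphic_on UNIV" "\<And>z. eventually (\<lambda>w. f w \<noteq> 0) (at z)" and "nev_order f = 0"
    and \<omega>: "\<And>r. r > 1 \<Longrightarrow> norm (\<omega> r) < sqrt (ln r)"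
  shows "eq_bigo_outside (\<lambda>r. nev_T r (\<lambda>z. f (z + \<omega> r))) (\<lambda>r. nev_T r f) ln"
proof -
  \<comment> \<open>With \<tau> < \<alpha> and |\<omega>| < sqrt(log r) the first term tends to 0;
    the second is at most (log r)^(1/16) log(1 + sqrt(log r)); and, as \<tau> < 1, the third is at
    most sqrt(log r).\<close>
  define \<tau> :: real where "\<tau> = 1/8"
  define \<alpha> :: real where "\<alpha> = 1/2"
  have \<tau>: "0 < \<tau>" "nev_order f < ereal \<tau>" and \<alpha>: "0 < \<alpha>" "\<alpha> < 1" using assms(3) by (auto simp: \<tau>_def \<alpha>_def)
  obtain C where C: "C \<ge> 0" "eventually (\<lambda>r. \<forall>w. norm w \<le> r \<longrightarrow>
    \<bar>nev_T r (\<lambda>z. f (z + w)) - nev_T r f\<bar> \<le> C * (r powr (\<tau> - \<alpha>) * ln r * norm w powr \<alpha> +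
      max 1 (norm w) powr \<tau> * ln (1 + norm w) + norm w * r powr max (\<tau> - 1) 0)) at_top"
    using nev_T_shift_estimate[OF assms(1,2) \<tau> \<alpha>] by blast
  have ev: "eventually (\<lambda>r. sqrt (ln r) \<le> r \<and> 1 \<le> sqrt (ln r) \<and>
      r powr (\<tau> - \<alpha>) * ln r * sqrt (ln r) powr \<alpha> \<le> ln r \<and>
      sqrt (ln r) powr \<tau> * ln (1 + sqrt (ln r)) \<le> ln r \<and> sqrt (ln r) \<le> ln r) at_top"
    unfolding \<tau>_def \<alpha>_def by (intro eventually_conj; real_asymp)
  show ?thesis
  proof (rule eq_bigo_outsideI[where C = "C * 3"])
    show "eventually (\<lambda>r. \<bar>nev_T r (\<lambda>z. f (z + \<omega> r)) - nev_T r f\<bar> \<le> C * 3 * ln r) at_top"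
      using C(2) ev eventually_gt_at_top[of 1]
    proof eventually_elim
      case (elim r)
      define s where "s = sqrt (ln r)"
      have s: "s \<le> r" "1 \<le> s" "r powr (\<tau> - \<alpha>) * ln r * s powr \<alpha> \<le> ln r" "s powr \<tau> * ln (1 + s) \<le> ln r" "s \<le> ln r"
        using elim(2) by (auto simp: s_def)
      have w: "norm (\<omega> r) \<le> s" using \<omega>[of r] elim by (simp add: s_def)
      have "\<bar>nev_T r (\<lambda>z. f (z + \<omega> r)) - nev_T r f\<bar> \<le> C * (r powr (\<tau> - \<alpha>) * ln r * norm (\<omega> r) powr \<alpha> +
          max 1 (norm (\<omega> r)) powr \<tau> * ln (1 + norm (\<omega> r)) + norm (\<omega> r) * r powr max (\<tau> - 1) 0)"
        using elim(1) w s by auto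
      also have "\<dots> \<le> C * (r powr (\<tau> - \<alpha>) * ln r * s powr \<alpha> + s powr \<tau> * ln (1 + s) + s * 1)"
      proof (intro mult_left_mono add_mono C(1) mult_mono powr_mono2)
        show "ln (1 + norm (\<omega> r)) \<le> ln (1 + s)" using w by (intro ln_mono) (auto intro: add_pos_nonneg)
        show "r powr max (\<tau> - 1) 0 \<le> 1" using elim by (simp add: \<tau>_def)
      qed (use elim w s \<tau> \<alpha> in auto)
      also have "\<dots> \<le> C * (ln r + ln r + ln r)" using s by (intro mult_left_mono add_mono C(1)) auto
      finally show ?case by simp
    qed
  qed
qed

theorem theorem3p4:
  fixes f :: "complex \<Rightarrow> complex" and \<sigma> :: real
  assumes "f meromorphic_on UNIV"
    and "nev_order f = ereal \<sigma>"
  shows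
    "(\<sigma> \<ge> 1 \<longrightarrow>
       (\<forall>(\<beta>::real) (\<epsilon>::real) (\<omega>::real \<Rightarrow> complex).
          0 < \<beta> \<and> \<beta> < 1 \<and>
          (\<forall>r>0. 0 < norm (\<omega> r) \<and> norm (\<omega> r) < r powr \<beta>) \<and>
          0 < \<epsilon> \<and> \<epsilon> < min ((\<sigma> - 1) * (1 - \<beta>) / \<beta>) ((1 - \<beta>) / (2 - \<beta>)) \<longrightarrow>
          eq_bigo_outside (\<lambda>r. nev_T r (\<lambda>z. f (z + \<omega> r))) (\<lambda>r. nev_T r f)
            (\<lambda>r. r powr (\<sigma> - (1 - \<beta>) * (1 - \<epsilon>) + \<epsilon>)))) \<and>
     (0 < \<sigma> \<and> \<sigma> < 1 \<longrightarrow>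
       (\<forall>(\<beta>::real) (\<omega>::real \<Rightarrow> complex).
          0 < \<beta> \<and> \<beta> < \<sigma> \<and>
          (\<forall>r>0. 0 < norm (\<omega> r) \<and> norm (\<omega> r) < r powr \<beta>) \<longrightarrow>
          eq_bigo_outside (\<lambda>r. nev_T r (\<lambda>z. f (z + \<omega> r))) (\<lambda>r. nev_T r f)
            (\<lambda>r. r powr \<beta>))) \<and>
     (\<sigma> = 0 \<longrightarrow>
       (\<forall>\<omega>::real \<Rightarrow> complex.
          (\<forall>r>1. 0 < norm (\<omega> r) \<and> norm (\<omega> r) < sqrt (ln r)) \<and>
          (\<forall>r. 0 < r \<and> r \<le> 1 \<longrightarrow> 0 < norm (\<omega> r) \<and> norm (\<omega> r) < 1) \<longrightarrow>
          eq_bigo_outside (\<lambda>r. nev_T r (\<lambda>z. f (z + \<omega> r))) (\<lambda>r. nev_T r f)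
            (\<lambda>r. ln r)))"
proof (cases "eventually (\<lambda>z. f z = 0) (cosparse UNIV)")
  case True
  have "eq_bigo_outside (\<lambda>r. nev_T r (\<lambda>z. f (z + \<omega> r))) (\<lambda>r. nev_T r f) e" for \<omega> e
  proof (rule eq_bigo_outsideI[where C = 0])
    show "eventually (\<lambda>r. \<bar>nev_T r (\<lambda>z. f (z + \<omega> r)) - nev_T r f\<bar> \<le> 0 * e r) at_top"
      using eventually_gt_at_top[of 0]
      by eventually_elim (use nev_T_shift_eq_0[OF True] nev_T_shift_eq_0[OF True, of _ 0] in simp)
  qed
  then show ?thesis by blast
next
  case False
  \<comment> \<open>Identity theorem on the connected plane: f vanishes off a sparse set or is
    nonzero off one.\<close>
  then have "eventually (\<lambda>z. f z \<noteq> 0) (cosparse UNIV)"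
    using meromorphic_imp_constant_or_avoid[OF assms(1) open_UNIV connected_UNIV, of 0] by blast
  then have nz: "\<And>z. eventually (\<lambda>w. f w \<noteq> 0) (at z)" by (simp add: eventually_cosparse_open_eq)
  show ?thesis
  proof (intro conjI impI allI; (elim conjE)?)
    fix \<beta> \<epsilon> :: real and \<omega> :: "real \<Rightarrow> complex"
    assume \<sigma>: "1 \<le> \<sigma>" and \<beta>: "0 < \<beta>" "\<beta> < 1" and \<omega>: "\<forall>r>0. 0 < norm (\<omega> r) \<and> norm (\<omega> r) < r powr \<beta>"
      and \<epsilon>: "0 < \<epsilon>" "\<epsilon> < min ((\<sigma> - 1) * (1 - \<beta>) / \<beta>) ((1 - \<beta>) / (2 - \<beta>))"
    \<comment> \<open>This gives \<epsilon> < 1, so that 1 - \<epsilon> is admissible as the power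
      \<alpha>.\<close>
    have "(1 - \<beta>) / (2 - \<beta>) < 1" using \<beta> by simp
    then have \<epsilon>1: "\<epsilon> < 1" using \<epsilon> by simp
    have "\<beta> * \<epsilon> < \<epsilon>" using \<beta> \<epsilon> by simp
    have "(\<sigma> - 1) * (1 - \<beta>) \<ge> 0" using \<beta> \<sigma> by simp
    show "eq_bigo_outside (\<lambda>r. nev_T r (\<lambda>z. f (z + \<omega> r))) (\<lambda>r. nev_T r f)
            (\<lambda>r. r powr (\<sigma> - (1 - \<beta>) * (1 - \<epsilon>) + \<epsilon>))"
    \<comment> \<open>With these values the first exponent is exactly the claimed one, half of the
      final \<epsilon> going to \<tau> and half to the logarithm. The second leaves the reserve
      (\<sigma>-1)(1-\<beta>) + 2\<epsilon>(1-\<beta>), nonnegative as \<sigma> \<ge> 1.\<close>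
    proof (rule eq_bigo_outside_powr[OF assms(1) nz, where \<tau> = "\<sigma> + \<epsilon>/2" and \<alpha> = "1 - \<epsilon>" and \<delta> = "\<epsilon>/2"])
      show "\<sigma> + \<epsilon>/2 - (1 - \<epsilon>) + \<epsilon>/2 + (1 - \<epsilon>) * \<beta> \<le> \<sigma> - (1 - \<beta>) * (1 - \<epsilon>) + \<epsilon>" by (simp add: algebra_simps)
      show "\<beta> * (\<sigma> + \<epsilon>/2) + \<beta> * (\<epsilon>/2) \<le> \<sigma> - (1 - \<beta>) * (1 - \<epsilon>) + \<epsilon>"
        using \<open>(\<sigma> - 1) * (1 - \<beta>) \<ge> 0\<close> \<open>\<beta> * \<epsilon> < \<epsilon>\<close> by (simp add: algebra_simps)
      have "max (\<sigma> + \<epsilon>/2 - 1) 0 = \<sigma> + \<epsilon>/2 - 1" using \<sigma> \<epsilon> by simp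
      moreover have "\<sigma> - (1 - \<beta>) * (1 - \<epsilon>) + \<epsilon> = \<sigma> - 1 + \<beta> + 2 * \<epsilon> - \<beta> * \<epsilon>" by (simp add: algebra_simps)
      ultimately show "\<beta> + max (\<sigma> + \<epsilon>/2 - 1) 0 \<le> \<sigma> - (1 - \<beta>) * (1 - \<epsilon>) + \<epsilon>"
        using \<open>\<beta> * \<epsilon> < \<epsilon>\<close> \<epsilon>(1) by linarith
    qed (use \<sigma> \<beta> \<omega> \<epsilon> \<epsilon>1 assms(2) in auto)
  next
    fix \<beta> :: real and \<omega> :: "real \<Rightarrow> complex"
    assume \<sigma>: "0 < \<sigma>" "\<sigma> < 1" and \<beta>: "0 < \<beta>" "\<beta> < \<sigma>" and \<omega>: "\<forall>r>0. 0 < norm (\<omega> r) \<and> norm (\<omega> r) < r powr \<beta>"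
    define \<tau> where "\<tau> = (1 + \<sigma>) / 2"
    have \<tau>: "0 < \<tau>" "\<tau> < 1" "\<sigma> < \<tau>" using \<sigma> by (auto simp: \<tau>_def)
    \<comment> \<open>Taking \<alpha> = \<tau> cancels the powers of r in the first term, and this
      \<delta> solves \<delta> + \<tau>\<beta> = \<beta>. The near poles are covered by \<tau> +
      \<delta> \<le> 1, and the far ones contribute exactly the exponent \<beta> because \<tau> <
      1.\<close>
    define \<delta> where "\<delta> = \<beta> * (1 - \<tau>)"
    have \<delta>: "0 < \<delta>" "\<delta> \<le> 1 - \<tau>" using \<beta> \<sigma> \<tau> by (auto simp: \<delta>_def mult_left_le_one_le)
    show "eq_bigo_outside (\<lambda>r. nev_T r (\<lambda>z. f (z + \<omega> r))) (\<lambda>r. nev_T r f) (\<lambda>r. r powr \<beta>)"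
    proof (rule eq_bigo_outside_powr[OF assms(1) nz, where \<tau> = \<tau> and \<alpha> = \<tau> and \<delta> = \<delta>])
      show "\<tau> - \<tau> + \<delta> + \<tau> * \<beta> \<le> \<beta>" by (simp add: \<delta>_def algebra_simps)
      have "\<beta> * (\<tau> + \<delta>) \<le> \<beta> * 1" using \<beta> \<delta> by (intro mult_left_mono) auto
      then show "\<beta> * \<tau> + \<beta> * \<delta> \<le> \<beta>" by (simp add: distrib_left)
    qed (use \<sigma> \<tau> \<delta> \<beta> \<omega> assms(2) in auto)
  next
    fix \<omega> :: "real \<Rightarrow> complex"
    assume "\<sigma> = 0" "\<forall>r>1. 0 < norm (\<omega> r) \<and> norm (\<omega> r) < sqrt (ln r)"
    then show "eq_bigo_outside (\<lambda>r. nev_T r (\<lambda>z. f (z + \<omega> r))) (\<lambda>r. nev_T r f) (\<lambda>r. ln r)"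
      using assms(2) by (intro eq_bigo_outside_ln[OF assms(1) nz]) (auto simp: zero_ereal_def)
  qed
qed

end
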